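(* Every graph of maximum degree at most three has slope number at most five.
   Context: A straight-line drawing of a graph maps vertices to distinct points of the plane and edges to segments between the corresponding points not passing through any other vertex point (crossings allowed). The slope number of $G$ is the smallest $s$ such that $G$ has a straight-line drawing whose edges have at most $s$ distinct slopes. *)

theory Defs
  imports "HOL-Analysis.Analysis" "Graph_Theory.Digraph"
begin

text \<open>
  Finite simple undirected graphs are modelled by the locale \<open>graph\<close> of the Graph Theory library:
  finite, loopless, symmetric digraphs without multiple arcs.  An undirected edge is a pair of
  opposite arcs, so the degree of a vertex is its \<open>out_degree\<close>.
\<close>

text \<open>The value \<open>None\<close> is the slope of vertical lines.\<close>

definition slope :: "real \<times> real \<Rightarrow> real \<times> real \<Rightarrow> real option" where
  "slope P Q = (if fst P = fst Q then None
                else Some ((snd Q - snd P) / (fst Q - fst P)))"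

definition straight_line_drawing ::
  "('a, 'b) pre_digraph \<Rightarrow> ('a \<Rightarrow> real \<times> real) \<Rightarrow> bool" where
  "straight_line_drawing G p \<longleftrightarrow>
     inj_on p (verts G) \<and>
     (\<forall>e \<in> arcs G. \<forall>w \<in> verts G - {tail G e, head G e}.
        p w \<notin> closed_segment (p (tail G e)) (p (head G e)))"

definition drawing_slopes ::
  "('a, 'b) pre_digraph \<Rightarrow> ('a \<Rightarrow> real \<times> real) \<Rightarrow> real option set" where
  "drawing_slopes G p = (\<lambda>e. slope (p (tail G e)) (p (head G e))) ` arcs G"

definition slope_number :: "('a, 'b) pre_digraph \<Rightarrow> nat" where
  "slope_number G =
     (LEAST s. \<exists>p. straight_line_drawing G p \<and> card (drawing_slopes G p) \<le> s)"

text \<open>The two arcs of an undirected edge contribute the same slope.\<close>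

lemma slope_commute: "slope P Q = slope Q P"
proof -
  have "(snd Q - snd P) / (fst Q - fst P) = (snd P - snd Q) / (fst P - fst Q)"
    by (metis minus_diff_eq minus_divide_divide)
  then show ?thesis
    by (simp add: slope_def)
qed

text \<open>
  For a finite graph the cardinality and the minimum above are genuine: only finitely many slopes
  occur, and placing the vertices on a parabola gives a drawing.
\<close>

lemma (in fin_digraph) finite_drawing_slopes: "finite (drawing_slopes G p)"
  by (simp add: drawing_slopes_def)

lemma (in fin_digraph) straight_line_drawing_exists:
  "\<exists>p. straight_line_drawing G p"
proof -
  obtain f :: "'a \<Rightarrow> nat" where f: "inj_on f (verts G)"
    using finite_imp_inj_to_nat_seg[OF finite_verts] by blast
  define p where "p v = (real (f v), (real (f v))\<^sup>2)" for v
  have "inj_on p (verts G)"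
    using f by (auto simp: inj_on_def p_def)
  moreover have "p w \<notin> closed_segment (p (tail G e)) (p (head G e))"
    if e: "e \<in> arcs G" and w: "w \<in> verts G - {tail G e, head G e}" for e w
  proof
    define a b c where abc: "a = real (f (tail G e))" "b = real (f (head G e))" "c = real (f w)"
    assume "p w \<in> closed_segment (p (tail G e)) (p (head G e))"
    then obtain t where "p w = (1 - t) *\<^sub>R p (tail G e) + t *\<^sub>R p (head G e)"
      unfolding closed_segment_def by blast
    then have "c = (1 - t) * a + t * b \<and> c\<^sup>2 = (1 - t) * a\<^sup>2 + t * b\<^sup>2"
      unfolding p_def abc scaleR_Pair add_Pair prod.inject real_scaleR_def .
    then have c: "c = (1 - t) * a + t * b" and c2: "c\<^sup>2 = (1 - t) * a\<^sup>2 + t * b\<^sup>2"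
      by blast+
    have "t * (1 - t) * (a - b)\<^sup>2 = ((1 - t) * a\<^sup>2 + t * b\<^sup>2) - ((1 - t) * a + t * b)\<^sup>2"
      by algebra
    also have "\<dots> = 0"
      unfolding c[symmetric] c2[symmetric] by (rule diff_self)
    finally consider "t = 0" | "t = 1" | "a = b"
      by (metis mult_eq_0_iff power_eq_0_iff right_minus_eq)
    then have "c = a \<or> c = b"
    proof cases
      case 3
      then have "c = b"
        using c by (metis add.commute diff_add_cancel distrib_right mult_1)
      then show ?thesis ..
    qed (simp_all add: c)
    then have "f w = f (tail G e) \<or> f w = f (head G e)"
      by (simp add: abc)
    then show False
      using inj_onD[OF f] e w tail_in_verts head_in_verts by blast
  qed
  ultimately show ?thesis
    unfolding straight_line_drawing_def by blast
qed

lemma (in fin_digraph) slope_number_le_iff: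
  "slope_number G \<le> s \<longleftrightarrow>
     (\<exists>p. straight_line_drawing G p \<and> card (drawing_slopes G p) \<le> s)"
proof
  let ?P = "\<lambda>s. \<exists>p. straight_line_drawing G p \<and> card (drawing_slopes G p) \<le> s"
  show "slope_number G \<le> s" if "?P s"
    unfolding slope_number_def using that by (rule Least_le)
  have "\<exists>s. ?P s"
    using straight_line_drawing_exists by blast
  then have "?P (slope_number G)"
    unfolding slope_number_def by (rule LeastI_ex)
  then show "?P s" if "slope_number G \<le> s"
    using that by (meson order_trans)
qed

end

theory Submission
  imports Defs
begin

text \<open>
  The edges of a graph of maximum degree three split into two linear forests \<open>F\<close> and \<open>H\<close>.  Let
  \<open>F\<close> run along a list \<open>xs\<close> of all vertices and \<open>H\<close> along another such list \<open>ys\<close>.  Let the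
  ordinate increase along \<open>xs\<close>, by \<open>d \<bar>\<Delta>x\<bar>\<close> on every edge of \<open>F\<close> and by \<open>1\<close> on every other step,
  and let the abscissa increase along \<open>ys\<close>, by \<open>d \<bar>\<Delta>y\<bar>\<close> on every edge of \<open>H\<close> and by \<open>1\<close> on every
  other step.  For small \<open>d\<close> these equations are solvable, the slopes are \<open>\<plusminus> d\<close> and \<open>\<plusminus> 1 / d\<close>, and
  no vertex lies on a foreign edge because the two coordinates are monotone.

  Vertices can only collapse to a point as a set \<open>W\<close> that spans paths of \<open>F\<close> and of \<open>H\<close>, and then
  \<open>W\<close> contains \<open>2 (card W - 1)\<close> edges; in a simple graph with all degrees at most three this forces \<open>W\<close>
  to be a component \<open>K\<^sub>4\<close>.  Such components are drawn separately, as parallelograms with the additional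
  slope \<open>d ^ 3\<close>.
\<close>

section \<open>Linear forests\<close>

text \<open>
  A symmetric relation is a linear forest if its edges join consecutive elements of some
  enumeration of the vertices; consecutive elements need not be joined.
\<close>

fun steps :: "'a list \<Rightarrow> ('a \<times> 'a) set" where
  "steps (x # y # zs) = {(x, y), (y, x)} \<union> steps (y # zs)"
| "steps _ = {}"

abbreviation edge :: "'a \<Rightarrow> 'a \<Rightarrow> ('a \<times> 'a) set" where
  "edge u v \<equiv> {(u, v), (v, u)}"

definition linear_forest :: "'a set \<Rightarrow> ('a \<times> 'a) set \<Rightarrow> bool" where
  "linear_forest V R \<longleftrightarrow> (\<exists>xs. distinct xs \<and> set xs = V \<and> R \<subseteq> steps xs)"

text \<open>Degree at most one: isolated vertices count as end vertices too.\<close>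

definition end_vertex :: "('a \<times> 'a) set \<Rightarrow> 'a \<Rightarrow> bool" where
  "end_vertex R v \<longleftrightarrow> (\<forall>x y. (v, x) \<in> R \<longrightarrow> (v, y) \<in> R \<longrightarrow> x = y)"

lemma steps_Cons: "xs \<noteq> [] \<Longrightarrow> steps (x # xs) = edge x (hd xs) \<union> steps xs"
  by (cases xs) auto

lemma steps_append:
  "xs \<noteq> [] \<Longrightarrow> ys \<noteq> [] \<Longrightarrow> steps (xs @ ys) = steps xs \<union> edge (last xs) (hd ys) \<union> steps ys"
  by (induction xs rule: steps.induct) (auto simp: steps_Cons)

lemma steps_append_superset: "steps xs \<union> steps ys \<subseteq> steps (xs @ ys)"
  by (cases "xs = [] \<or> ys = []") (auto simp: steps_append)

lemma steps_rev [simp]: "steps (rev xs) = steps xs"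
proof (induction xs)
  case (Cons x xs)
  then show ?case
    by (cases "xs = []") (auto simp: steps_append steps_Cons last_rev)
qed simp

lemma linear_forest_subset: "linear_forest V R \<Longrightarrow> Q \<subseteq> R \<Longrightarrow> linear_forest V Q"
  unfolding linear_forest_def by blast

text \<open>Since \<open>a\<close> has at most one neighbour, \<open>zs\<close> can be cut just
  before or just after \<open>a\<close> without cutting an edge of \<open>R\<close>. The piece
  bordered by \<open>a\<close>, reversed if \<open>a\<close> is its last element, is put right after
  \<open>b\<close>, and the other piece follows.\<close>

lemma linear_forest_join:
  assumes "sym R" and R: "R \<subseteq> steps (ys @ [b]) \<union> steps zs"
    and dist: "distinct (ys @ b # zs)" and V: "set (ys @ b # zs) = V"
    and "a \<in> set zs" and a: "end_vertex R a"
  shows "linear_forest V (R \<union> edge a b)"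
proof -
  obtain l r where zs: "zs = l @ a # r"
    using \<open>a \<in> set zs\<close> by (meson split_list)
  consider (left) "l = [] \<or> (a, last l) \<notin> R" | (right) "r = [] \<or> (a, hd r) \<notin> R"
  proof (cases "l = [] \<or> r = []")
    case False
    then have "last l \<noteq> hd r"
      using dist unfolding zs by (auto dest: last_in_set hd_in_set)
    then show ?thesis
      using a that unfolding end_vertex_def by blast
  qed (use that in blast)
  then show ?thesis
  proof cases
    case left
    have "R \<subseteq> steps (ys @ [b]) \<union> steps l \<union> steps (a # r)"
      using R left \<open>sym R\<close> unfolding zs
      by (cases "l = []") (auto simp: steps_append dest: symD)
    then have "R \<union> edge a b \<subseteq> steps ((ys @ [b]) @ (a # r) @ l)"
      using steps_append_superset[of "a # r" l]
      by (subst steps_append) auto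
    then show ?thesis
      using dist V unfolding linear_forest_def zs
      by (intro exI[of _ "(ys @ [b]) @ (a # r) @ l"]) auto
  next
    case right
    have "R \<subseteq> steps (ys @ [b]) \<union> steps (l @ [a]) \<union> steps r"
      using R right \<open>sym R\<close> steps_append_superset[of l "[a]"] unfolding zs
      by (cases "l = []"; cases "r = []") (auto simp: steps_append steps_Cons dest: symD)
    then have "R \<subseteq> steps (ys @ [b]) \<union> steps (rev (l @ [a])) \<union> steps r"
      by (simp only: steps_rev)
    then have "R \<union> edge a b \<subseteq> steps ((ys @ [b]) @ rev (l @ [a]) @ r)"
      using steps_append_superset[of "rev (l @ [a])" r]
      by (subst steps_append) auto
    then show ?thesis
      using dist V unfolding linear_forest_def zs
      by (intro exI[of _ "(ys @ [b]) @ rev (l @ [a]) @ r"]) auto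
  qed
qed

text \<open>An isolated \<open>u\<close> can be taken out of the enumeration and listed on its own,
  so that \<open>linear_forest_join\<close> applies with \<open>[u]\<close> as the list that ends in
  \<open>b\<close>.\<close>

lemma linear_forest_insert_isolated:
  assumes "sym R" and "linear_forest V R" and "u \<in> V" "v \<in> V" "u \<noteq> v"
    and u: "u \<notin> Domain R" and "end_vertex R v"
  shows "linear_forest V (R \<union> edge u v)"
proof -
  obtain xs where xs: "distinct xs" "set xs = V" "R \<subseteq> steps xs"
    using assms(2) unfolding linear_forest_def by blast
  then obtain l r where lr: "xs = l @ u # r"
    using \<open>u \<in> V\<close> by (meson split_list)
  have u': "(x, u) \<notin> R" "(u, x) \<notin> R" for x
    using u \<open>sym R\<close> by (auto dest: symD)
  have "R \<subseteq> steps (l @ r)"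
  proof (rule subsetI)
    fix e assume "e \<in> R"
    then have "e \<in> steps (l @ u # r)" "e \<noteq> (x, u)" "e \<noteq> (u, x)" for x
      using xs(3) u' unfolding lr by auto
    then have "e \<in> steps l \<union> steps r"
      by (cases "l = []"; cases "r = []") (auto simp: steps_append steps_Cons)
    then show "e \<in> steps (l @ r)"
      using steps_append_superset by fast
  qed
  then have "R \<subseteq> steps ([] @ [u]) \<union> steps (l @ r)"
    by simp
  moreover have "distinct ([] @ u # l @ r)" "set ([] @ u # l @ r) = V" "v \<in> set (l @ r)"
    using xs \<open>v \<in> V\<close> \<open>u \<noteq> v\<close> by (auto simp: lr)
  ultimately have "linear_forest V (R \<union> edge v u)"
    using linear_forest_join[OF \<open>sym R\<close>, of "[]" u] \<open>end_vertex R v\<close> by blast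
  then show ?thesis
    by (simp add: insert_commute)
qed

text \<open>A path has only two ends, so \<open>b\<close> cannot be joined to both of the others by paths of \<open>R\<close>.\<close>

lemma linear_forest_join_one_of_two:
  assumes "sym R" and "linear_forest V R" and V: "a \<in> V" "b \<in> V" "c \<in> V"
    and neq: "a \<noteq> b" "b \<noteq> c" "a \<noteq> c"
    and ends: "end_vertex R a" "end_vertex R b" "end_vertex R c"
  shows "linear_forest V (R \<union> edge a b) \<or> linear_forest V (R \<union> edge c b)"
proof -
  \<comment> \<open>As \<open>b\<close> is an end vertex, the enumeration can be cut beside it; the
    piece with \<open>b\<close> is reversed if \<open>b\<close> comes first in it.\<close>
  have *: "\<exists>ys zs. R \<subseteq> steps (ys @ [b]) \<union> steps zs \<and> distinct (ys @ b # zs) \<and> set (ys @ b # zs) = V"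
  proof -
    obtain xs where xs: "distinct xs" "set xs = V" "R \<subseteq> steps xs"
      using assms(2) unfolding linear_forest_def by blast
    then obtain l r where lr: "xs = l @ b # r"
      using \<open>b \<in> V\<close> by (meson split_list)
    consider (left) "l = [] \<or> (b, last l) \<notin> R" | (right) "r = [] \<or> (b, hd r) \<notin> R"
    proof (cases "l = [] \<or> r = []")
      case False
      then have "last l \<noteq> hd r"
        using xs(1) unfolding lr by (auto dest: last_in_set hd_in_set)
      then show ?thesis
        using ends(2) that unfolding end_vertex_def by blast
    qed (use that in blast)
    then show ?thesis
    proof cases
      case left
      have "R \<subseteq> steps (b # r) \<union> steps l"
        using xs(3) left \<open>sym R\<close> unfolding lr
        by (cases "l = []") (auto simp: steps_append dest: symD)
      then have "R \<subseteq> steps (rev (b # r)) \<union> steps l"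
        by (simp only: steps_rev)
      then show ?thesis
        using xs(1,2) unfolding lr by (intro exI[of _ "rev r"] exI[of _ l]) auto
    next
      case right
      have "R \<subseteq> steps (l @ [b]) \<union> steps r"
        using xs(3) right \<open>sym R\<close> steps_append_superset[of l "[b]"] unfolding lr
        by (cases "l = []"; cases "r = []") (auto simp: steps_append steps_Cons dest: symD)
      then show ?thesis
        using xs(1,2) unfolding lr by (intro exI[of _ l] exI[of _ r]) auto
    qed
  qed
  then obtain ys zs where R: "R \<subseteq> steps (ys @ [b]) \<union> steps zs"
    and dist: "distinct (ys @ b # zs)" and set: "set (ys @ b # zs) = V"
    by blast
  \<comment> \<open>Both vertices share a list with \<open>b\<close>, here with \<open>a\<close>
    before \<open>c\<close>. As \<open>c\<close> is an end vertex, one of the two list steps at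
    \<open>c\<close> is no edge of \<open>R\<close>. A cut before \<open>c\<close> separates
    \<open>a\<close> from \<open>b\<close>, a cut after \<open>c\<close> separates \<open>c\<close>
    from \<open>b\<close>; the separated vertex can be joined to \<open>b\<close>.\<close>
  have order: "linear_forest V (R \<union> edge a b) \<or> linear_forest V (R \<union> edge c b)"
    if ys: "ys = p @ a # q @ c # r" and a: "end_vertex R a" and c: "end_vertex R c" for a c p q r
  proof -
    let ?m = "last (a # q)"
    have split: "steps (ys @ [b]) = steps (p @ a # q) \<union> edge ?m c \<union> steps (c # r @ [b])"
      using steps_append[of "p @ a # q" "c # r @ [b]"] unfolding ys by (auto split: if_splits)
    have split': "steps (c # r @ [b]) = edge c (hd (r @ [b])) \<union> steps (r @ [b])"
      by (rule steps_Cons) simp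
    have "?m \<noteq> hd (r @ [b])"
    proof -
      have "?m \<in> set (a # q)" "hd (r @ [b]) \<in> set (r @ [b])"
        by (rule last_in_set, simp, rule hd_in_set, simp)
      then show ?thesis
        using dist unfolding ys by auto
    qed
    then consider "(c, ?m) \<notin> R" | "(c, hd (r @ [b])) \<notin> R"
      using c unfolding end_vertex_def by blast
    then show ?thesis
    proof cases
      case 1
      have "R \<subseteq> steps ((c # r) @ [b]) \<union> steps (p @ a # q) \<union> steps zs"
        using R 1 \<open>sym R\<close> unfolding split by (auto dest: symD)
      then have "R \<subseteq> steps ((c # r) @ [b]) \<union> steps ((p @ a # q) @ zs)"
        using steps_append_superset[of "p @ a # q" zs] by blast
      moreover have "distinct ((c # r) @ b # (p @ a # q) @ zs)"
        "set ((c # r) @ b # (p @ a # q) @ zs) = V"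
        using dist set unfolding ys by auto
      ultimately have "linear_forest V (R \<union> edge a b)"
        by (rule linear_forest_join[OF \<open>sym R\<close> _ _ _ _ a]) simp
      then show ?thesis ..
    next
      case 2
      have "R \<subseteq> steps (r @ [b]) \<union> (steps (p @ a # q) \<union> edge ?m c) \<union> steps zs"
        using R 2 \<open>sym R\<close> unfolding split split' by (auto dest: symD)
      also have "steps (p @ a # q) \<union> edge ?m c = steps ((p @ a # q) @ [c])"
        by (subst steps_append) auto
      finally have "R \<subseteq> steps (r @ [b]) \<union> steps (((p @ a # q) @ [c]) @ zs)"
        using steps_append_superset[of "(p @ a # q) @ [c]" zs] by blast
      moreover have "distinct (r @ b # ((p @ a # q) @ [c]) @ zs)"
        "set (r @ b # ((p @ a # q) @ [c]) @ zs) = V"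
        using dist set unfolding ys by auto
      ultimately have "linear_forest V (R \<union> edge c b)"
        by (rule linear_forest_join[OF \<open>sym R\<close> _ _ _ _ c]) simp
      then show ?thesis ..
    qed
  qed
  consider "a \<in> set zs" | "c \<in> set zs" | "a \<in> set ys" "c \<in> set ys"
    using V neq set by auto
  then show ?thesis
  proof cases
    case 3
    obtain p r where p: "ys = p @ a # r"
      using 3 by (meson split_list)
    then consider "c \<in> set p" | "c \<in> set r"
      using 3 neq by auto
    then show ?thesis
    proof cases
      case 1
      then obtain p' q' where "p = p' @ c # q'"
        by (meson split_list)
      then have "ys = p' @ c # q' @ a # r"
        using p by simp
      then show ?thesis
        using order ends by blast
    next
      case 2
      then obtain p' q' where "r = p' @ c # q'"
        by (meson split_list)
      then have "ys = p @ a # p' @ c # q'"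
        using p by simp
      then show ?thesis
        using order ends by blast
    qed
  qed (use linear_forest_join[OF \<open>sym R\<close> R dist set] ends in blast)+
qed

section \<open>Splitting a subcubic graph into two linear forests\<close>

text \<open>The share of colour \<open>c\<close> when a path is distributed over two linear forests,
  the colours being the two truth values. Each vertex decides the colour of the edge to its
  successor, so that a colour free at the vertex can be used there.\<close>

fun coloured_steps :: "('a \<Rightarrow> bool) \<Rightarrow> bool \<Rightarrow> 'a list \<Rightarrow> ('a \<times> 'a) set" where
  "coloured_steps s c (x # y # zs) = (if s x = c then edge x y else {}) \<union> coloured_steps s c (y # zs)"
| "coloured_steps s c _ = {}"

lemma sym_edge: "sym (edge u v)"
  by (auto simp: sym_def)

lemma sym_coloured_steps: "sym (coloured_steps s c qs)"
  by (induction s c qs rule: coloured_steps.induct) (auto simp: sym_Un sym_edge)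

lemma coloured_steps_Un: "coloured_steps s True qs \<union> coloured_steps s False qs = steps qs"
  by (induction qs rule: steps.induct) auto

lemma coloured_steps_in_set:
  "(u, v) \<in> coloured_steps s c qs \<Longrightarrow> u \<in> set qs \<and> v \<in> set qs"
  by (induction s c qs rule: coloured_steps.induct) (auto split: if_splits)

lemma coloured_steps_last:
  "(last qs, w) \<in> coloured_steps s c qs \<Longrightarrow> distinct qs \<Longrightarrow> w = last (butlast qs) \<and> s w = c"
proof (induction s c qs rule: coloured_steps.induct)
  case (1 s c x y zs)
  show ?case
  proof (cases zs)
    case Nil
    then show ?thesis
      using 1 by (auto split: if_splits)
  next
    case (Cons z zs')
    then have "last zs \<in> set zs"
      by simp
    then have "last zs \<noteq> x" "last zs \<noteq> y"
      using 1(3) by auto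
    then show ?thesis
      using 1 Cons by (auto split: if_splits)
  qed
qed auto

lemma end_vertex_if_isolated: "v \<notin> Domain R \<Longrightarrow> end_vertex R v"
  unfolding end_vertex_def by blast

lemma end_vertex_subset: "end_vertex R v \<Longrightarrow> Q \<subseteq> R \<Longrightarrow> end_vertex Q v"
  unfolding end_vertex_def by blast

lemma end_vertex_Un: "end_vertex R v \<Longrightarrow> end_vertex Q v \<Longrightarrow> v \<notin> Domain R \<or> v \<notin> Domain Q \<Longrightarrow> end_vertex (R \<union> Q) v"
  unfolding end_vertex_def by blast

text \<open>The induction adds the edges from the end of the path backwards. When the edge from
  \<open>x\<close> to \<open>y\<close> comes in, \<open>x\<close> has no edge of its colour yet. And
  \<open>y\<close> has at most one: if its own path edge has this colour, then the colour was free
  at \<open>y\<close> in \<open>D\<close>; otherwise only an edge of \<open>D\<close> is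
  possible.\<close>

lemma linear_forest_add_path:
  assumes "\<And>c. sym (D c)" and "\<And>c. linear_forest V (D c)"
    and "distinct qs" and "set qs \<subseteq> V"
    and "\<And>v. v \<in> set (butlast qs) \<Longrightarrow> v \<notin> Domain (D (s v))"
    and "\<And>v. v \<in> set (tl qs) \<Longrightarrow> end_vertex (D (\<not> s v)) v"
    and "\<And>c. qs \<noteq> [] \<Longrightarrow> end_vertex (D c) (last qs)"
  shows "linear_forest V (D c \<union> coloured_steps s c qs)"
  using assms(3-)
proof (induction qs rule: steps.induct)
  case (1 x y zs)
  have IH: "linear_forest V (D c \<union> coloured_steps s c (y # zs))"
  proof (rule "1.IH")
    show "v \<notin> Domain (D (s v))" if "v \<in> set (butlast (y # zs))" for v
      using that 1(4) by auto
    show "end_vertex (D (\<not> s v)) v" if "v \<in> set (tl (y # zs))" for v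
      using that 1(5)[of v] by auto
    show "end_vertex (D c) (last (y # zs))" for c
      using 1(6) by simp
  qed (use 1(2,3) in auto)
  show ?case
  proof (cases "s x = c")
    case True
    let ?R = "D c \<union> coloured_steps s c (y # zs)"
    have "x \<notin> Domain ?R"
      using 1(2) 1(4)[of x] True by (auto dest: coloured_steps_in_set)
    moreover have "end_vertex ?R y"
    proof (cases zs)
      case Nil
      then show ?thesis
        using 1(6)[of c] by simp
    next
      case (Cons z zs')
      have "y \<notin> Domain (coloured_steps s c (z # zs'))"
        using 1(2) Cons by (auto dest: coloured_steps_in_set)
      moreover have "y \<notin> Domain (D c)" if "s y = c"
        using 1(4)[of y] Cons that by auto
      moreover have "end_vertex (D c) y" if "s y \<noteq> c"
      proof -
        have "c = (\<not> s y)"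
          using that by blast
        then show ?thesis
          using 1(5)[of y] by simp
      qed
      ultimately show ?thesis
        using Cons 1(2) unfolding end_vertex_def by (cases "s y = c") auto
    qed
    moreover have "sym ?R"
      by (intro sym_Un assms(1) sym_coloured_steps)
    ultimately have "linear_forest V (?R \<union> edge x y)"
      using 1(2,3) IH by (intro linear_forest_insert_isolated) auto
    also have "?R \<union> edge x y = D c \<union> coloured_steps s c (x # y # zs)"
      using True by auto
    finally show ?thesis .
  qed (use IH in simp)
qed (simp_all add: assms)

text \<open>
  Each vertex \<open>v\<close> of the cycle lends its free colour \<open>s v\<close> to the edge towards its successor.  If the
  edges are added in a suitable order, every one of them but the last is attached at a vertex that is
  isolated in the colour used.
\<close>

lemma linear_forests_add_cycle:
  assumes sym: "\<And>c. sym (D c)" and lin: "\<And>c. linear_forest V (D c)"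
    and dist: "distinct (x # y # zs)" and "zs \<noteq> []" and V: "set (x # y # zs) \<subseteq> V"
    and iso: "\<And>v. v \<in> set (x # y # zs) \<Longrightarrow> v \<notin> Domain (D (s v))"
    and ends: "\<And>v. v \<in> set (x # y # zs) \<Longrightarrow> end_vertex (D (\<not> s v)) v"
  shows "\<exists>D'. (\<forall>c. sym (D' c) \<and> linear_forest V (D' c)) \<and>
    D' True \<union> D' False = D True \<union> D False \<union> steps (x # y # zs) \<union> edge (last zs) x"
proof (cases "s x = s y")
  case False
  \<comment> \<open>Here the edge between \<open>x\<close> and \<open>y\<close> goes in first, in
    the colour \<open>s x\<close>. As this differs from \<open>s y\<close>, the remaining path from
    \<open>y\<close> round to \<open>x\<close> meets the hypotheses of
    \<open>linear_forest_add_path\<close>.\<close>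
  define D1 where "D1 c = D c \<union> (if c = s x then edge x y else {})" for c
  have ends': "end_vertex (D c) v" if "v \<in> set (x # y # zs)" for v c
    using ends[OF that] end_vertex_if_isolated[OF iso[OF that]] by (cases "c = s v") auto
  have "x \<noteq> y"
    using dist by simp
  have D1_iff: "(v, w) \<in> D1 c \<longleftrightarrow> (v, w) \<in> D c \<or> c = s x \<and> (v = x \<and> w = y \<or> v = y \<and> w = x)" for v w c
    unfolding D1_def by auto
  have lin1: "linear_forest V (D1 c)" for c
  proof (cases "c = s x")
    case True
    then have "linear_forest V (D c \<union> edge x y)"
      using dist V iso[of x] ends'[of y c] by (intro linear_forest_insert_isolated sym lin) auto
    then show ?thesis
      using True by (simp add: D1_def)
  qed (simp add: D1_def lin)
  have sym1: "sym (D1 c)" for c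
    using sym[of c] unfolding D1_def sym_def by auto
  define D' where "D' c = D1 c \<union> coloured_steps s c (y # zs @ [x])" for c
  have "linear_forest V (D' c)" for c
    unfolding D'_def
  proof (rule linear_forest_add_path[OF sym1 lin1])
    show "v \<notin> Domain (D1 (s v))" if "v \<in> set (butlast (y # zs @ [x]))" for v
    proof -
      have "v \<in> set (x # y # zs)" "v \<noteq> x"
        using that dist by (auto simp: butlast_append split: if_splits)
      then show ?thesis
        using iso[of v] D1_iff False by fastforce
    qed
    show "end_vertex (D1 (\<not> s v)) v" if "v \<in> set (tl (y # zs @ [x]))" for v
    proof -
      have "v \<in> set (x # y # zs)" "v \<noteq> y"
        using that dist by auto
      then show ?thesis
        using ends'[of v "\<not> s v"] by (auto simp: D1_iff end_vertex_def)
    qed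
    have "end_vertex (D1 c) x" for c
    proof (cases "c = s x")
      case True
      then have "(x, w) \<notin> D c" for w
        using iso[of x] by auto
      then show ?thesis
        using True \<open>x \<noteq> y\<close> by (auto simp: D1_iff end_vertex_def)
    next
      case False
      then show ?thesis
        using ends'[of x c] by (simp add: D1_iff end_vertex_def)
    qed
    then show "end_vertex (D1 c) (last (y # zs @ [x]))" for c
      by simp
  qed (use dist V in auto)
  moreover have "sym (D' c)" for c
    unfolding D'_def by (intro sym_Un sym1 sym_coloured_steps)
  moreover have "D' True \<union> D' False = D True \<union> D False \<union> steps (x # y # zs) \<union> edge (last zs) x"
  proof -
    have "D' True \<union> D' False = D True \<union> D False \<union> edge x y \<union> steps ((y # zs) @ [x])"
      using coloured_steps_Un[of s "y # zs @ [x]"] unfolding D'_def D1_def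
      by (cases "s x") (auto simp del: coloured_steps.simps)
    also have "steps ((y # zs) @ [x]) = steps (y # zs) \<union> edge (last zs) x"
      using \<open>zs \<noteq> []\<close> by (subst steps_append) auto
    finally show ?thesis
      by auto
  qed
  ultimately show ?thesis
    by blast
next
  case True
  \<comment> \<open>Now the whole path from \<open>x\<close> to the last vertex \<open>l\<close>
    goes in first, giving \<open>P\<close>, and only the closing edge remains.\<close>
  define c0 where "c0 = s x"
  define l where "l = last zs"
  have l: "l \<in> set zs" "last (x # y # zs) = l"
    using \<open>zs \<noteq> []\<close> by (auto simp: l_def)
  have neq: "l \<noteq> x" "l \<noteq> y" "x \<noteq> y"
    using l dist by auto
  have inV: "x \<in> V" "y \<in> V" "l \<in> V"
    using l V by auto
  have ends': "end_vertex (D c) v" if "v \<in> set (x # y # zs)" for v c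
    using ends[OF that] end_vertex_if_isolated[OF iso[OF that]] by (cases "c = s v") auto
  define P where "P c = D c \<union> coloured_steps s c (x # y # zs)" for c
  have linP: "linear_forest V (P c)" for c
    unfolding P_def
  proof (rule linear_forest_add_path[OF sym lin])
    show "v \<notin> Domain (D (s v))" if "v \<in> set (butlast (x # y # zs))" for v
      using iso in_set_butlastD[OF that] by blast
    show "end_vertex (D (\<not> s v)) v" if "v \<in> set (tl (x # y # zs))" for v
      using that by (intro ends') auto
    show "end_vertex (D c) (last (x # y # zs))" for c
      unfolding l(2) using l(1) by (intro ends') auto
  qed (use dist V in auto)
  have symP: "sym (P c)" for c
    unfolding P_def by (intro sym_Un sym sym_coloured_steps)
  have P_Un: "P True \<union> P False = D True \<union> D False \<union> steps (x # y # zs)"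
    using coloured_steps_Un[of s "x # y # zs"] unfolding P_def by blast
  have x_nbr: "w = y \<and> c = c0" if "(x, w) \<in> coloured_steps s c (x # y # zs)" for w c
    using that dist by (auto simp: c0_def dest: coloured_steps_in_set split: if_splits)
  have ends_x: "end_vertex (P c) x" for c
    unfolding P_def
  proof (rule end_vertex_Un)
    show "end_vertex (D c) x"
      by (simp add: ends')
    show "end_vertex (coloured_steps s c (x # y # zs)) x"
      using x_nbr unfolding end_vertex_def by blast
    show "x \<notin> Domain (D c) \<or> x \<notin> Domain (coloured_steps s c (x # y # zs))"
    proof (cases "c = s x")
      case True
      then show ?thesis
        using iso[of x] by simp
    next
      case False
      then show ?thesis
        using x_nbr unfolding c0_def by blast
    qed
  qed
  \<comment> \<open>Both path edges at \<open>y\<close> have the colour \<open>c0\<close>, since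
    \<open>s x = s y\<close>.\<close>
  have "y \<notin> Domain (coloured_steps s (\<not> c0) (x # y # zs))"
    using dist True by (cases zs) (auto simp: c0_def dest: coloured_steps_in_set split: if_splits)
  then have ends_y: "end_vertex (P (\<not> c0)) y"
    unfolding P_def
    by (intro end_vertex_Un) (simp_all add: ends' end_vertex_if_isolated del: coloured_steps.simps)
  define close where
    "close Q \<longleftrightarrow> (\<forall>c. sym (Q c) \<and> linear_forest V (Q c)) \<and> Q True \<union> Q False = P True \<union> P False \<union> edge l x"
    for Q
  have closeI: "close (P (c := P c \<union> edge l x))" if "linear_forest V (P c \<union> edge l x)" for c
    using that linP symP sym_Un[OF symP[of c] sym_edge[of l x]] unfolding close_def by (cases c) auto
  have "\<exists>Q. close Q"
  proof (cases "l \<in> Domain (P (s l))")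
    case False
    then have "linear_forest V (P (s l) \<union> edge l x)"
      using inV neq by (intro linear_forest_insert_isolated symP linP ends_x) auto
    then show ?thesis
      using closeI by blast
  next
    \<comment> \<open>The colour \<open>s l\<close> is taken at \<open>l\<close> by the last path
      edge, so this edge does not count in the other colour and \<open>l\<close> has at most one
      edge in each.\<close>
    case l_used: True
    have l_nbr: "w = last (butlast (x # y # zs)) \<and> s w = c"
      if "(l, w) \<in> coloured_steps s c (x # y # zs)" for w c
      using coloured_steps_last[of "x # y # zs"] that dist unfolding l(2) by blast
    have l_col: "c = s l" if "(l, w) \<in> coloured_steps s c (x # y # zs)" for w c
    proof -
      obtain w' where "(l, w') \<in> coloured_steps s (s l) (x # y # zs)"
        using l_used iso[of l] l(1) unfolding P_def by (auto simp del: coloured_steps.simps)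
      then show ?thesis
        using l_nbr that by blast
    qed
    have ends_l: "end_vertex (P c) l" for c
      unfolding P_def
    proof (rule end_vertex_Un)
      show "end_vertex (D c) l"
        using l(1) by (simp add: ends')
      show "end_vertex (coloured_steps s c (x # y # zs)) l"
        using l_nbr unfolding end_vertex_def by blast
      show "l \<notin> Domain (D c) \<or> l \<notin> Domain (coloured_steps s c (x # y # zs))"
      proof (cases "c = s l")
        case True
        then show ?thesis
          using iso[of l] l(1) by simp
      next
        case False
        then show ?thesis
          using l_col by blast
      qed
    qed
    \<comment> \<open>In the colour \<open>\<not> c0\<close> the vertices \<open>l\<close>,
      \<open>x\<close>, \<open>y\<close> are all end vertices, so one of \<open>l\<close> and
      \<open>y\<close> can be joined to \<open>x\<close>.\<close>
    consider "linear_forest V (P (\<not> c0) \<union> edge l x)" | "linear_forest V (P (\<not> c0) \<union> edge y x)"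
      using linear_forest_join_one_of_two[OF symP linP inV(3,1,2)] neq ends_l ends_x ends_y by blast
    then show ?thesis
    proof cases
      case 1
      then show ?thesis
        using closeI by blast
    next
      case 2
      \<comment> \<open>The edge between \<open>x\<close> and \<open>y\<close> moves to the other
        colour. This isolates \<open>x\<close> in \<open>c0\<close>, where the closing edge can then
        be placed.\<close>
      let ?R = "P c0 - edge x y"
      have "linear_forest V ?R" "end_vertex ?R l"
        by (rule linear_forest_subset[OF linP] end_vertex_subset[OF ends_l], rule Diff_subset)+
      moreover have "sym ?R"
        using symP[of c0] by (auto simp: sym_def)
      moreover have "x \<notin> Domain ?R"
      proof -
        have "w = y" if "(x, w) \<in> P c0" for w
          using that x_nbr iso[of x] unfolding P_def c0_def by (auto simp del: coloured_steps.simps)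
        then show ?thesis
          by blast
      qed
      ultimately have lin0: "linear_forest V (?R \<union> edge x l)"
        using inV neq by (intro linear_forest_insert_isolated) auto
      define Q where "Q c = (if c = c0 then ?R \<union> edge x l else P (\<not> c0) \<union> edge y x)" for c
      have xy: "(x, y) \<in> P c0" "(y, x) \<in> P c0"
        by (auto simp: P_def c0_def)
      have "Q True \<union> Q False = P True \<union> P False \<union> edge l x"
        using xy unfolding Q_def by (cases c0) auto
      moreover have "sym (Q c)" for c
        using sym_Un[OF \<open>sym ?R\<close> sym_edge[of x l]] sym_Un[OF symP[of "\<not> c0"] sym_edge[of y x]]
        unfolding Q_def by (split if_split) blast
      moreover have "linear_forest V (Q c)" for c
        using lin0 2 unfolding Q_def by (split if_split) blast
      ultimately show ?thesis
        unfolding close_def by blast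
    qed
  qed
  then show ?thesis
    unfolding close_def P_Un l_def by blast
qed

section \<open>Cycles and the inductive splitting\<close>

text \<open>In a longest path, the first vertex \<open>x\<close> has a neighbour \<open>w\<close>
  other than the second vertex \<open>y\<close>. As the path cannot be extended, \<open>w\<close>
  lies on it, and the part up to \<open>w\<close> closes to a cycle.\<close>

lemma exists_cycle:
  assumes "finite V" and "E \<subseteq> V \<times> V" and "sym E" and "irrefl E" and "E \<noteq> {}"
    and two: "\<And>u v. (u, v) \<in> E \<Longrightarrow> \<not> end_vertex E u"
  shows "\<exists>x y zs. zs \<noteq> [] \<and> distinct (x # y # zs) \<and> steps (x # y # zs) \<union> edge (last zs) x \<subseteq> E"
proof -
  define path where "path qs \<longleftrightarrow> (\<exists>x y zs. qs = x # y # zs) \<and> distinct qs \<and> steps qs \<subseteq> E" for qs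
  have V: "set qs \<subseteq> V" if "path qs" for qs
  proof -
    obtain x y zs where "qs = x # y # zs"
      using \<open>path qs\<close> unfolding path_def by blast
    then have "v \<in> Domain (steps qs)" if "v \<in> set qs" for v
      using that
    proof (induction zs arbitrary: qs x y)
      case (Cons z zs)
      then show ?case
        using Cons.IH[of "y # z # zs" y z] by (cases "v = x") auto
    qed auto
    then show ?thesis
      using \<open>path qs\<close> assms(2) unfolding path_def by blast
  qed
  have "length qs \<le> card V" if "path qs" for qs
    using V[OF that] that card_mono[OF \<open>finite V\<close>, of "set qs"]
    unfolding path_def by (simp add: distinct_card)
  moreover obtain u v where "(u, v) \<in> E"
    using \<open>E \<noteq> {}\<close> by auto
  then have "path [u, v]"
    using \<open>sym E\<close> \<open>irrefl E\<close> unfolding path_def by (auto simp: irrefl_def dest: symD)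
  ultimately obtain qs where qs: "path qs" and longest: "\<And>qs'. path qs' \<Longrightarrow> length qs' \<le> length qs"
    using ex_has_greatest_nat[of path "[u, v]" length "card V + 1"] by (metis Suc_eq_plus1 le_imp_less_Suc)
  then obtain x y zs where xy: "qs = x # y # zs"
    unfolding path_def by blast
  have "(x, y) \<in> E"
    using qs unfolding path_def xy by auto
  then obtain w where w: "(x, w) \<in> E" "w \<noteq> y"
    using two unfolding end_vertex_def by metis
  have "w \<in> set qs"
  proof (rule ccontr)
    assume "w \<notin> set qs"
    then have "path (w # qs)"
      using qs w \<open>sym E\<close> unfolding path_def xy by (auto dest: symD)
    then show False
      using longest by fastforce
  qed
  then have "w \<in> set zs"
    using w \<open>irrefl E\<close> unfolding xy by (auto simp: irrefl_def)
  then obtain p r where zs: "zs = p @ w # r"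
    by (meson split_list)
  have "steps (x # y # p @ [w]) \<subseteq> steps qs"
    using steps_append_superset[of "x # y # p @ [w]" r] unfolding xy zs by simp
  then have "steps (x # y # p @ [w]) \<union> edge (last (p @ [w])) x \<subseteq> E"
    using qs w \<open>sym E\<close> unfolding path_def by (auto dest: symD)
  moreover have "distinct (x # y # p @ [w])"
    using qs unfolding path_def xy zs by auto
  ultimately show ?thesis
    by blast
qed

lemma sym_steps: "sym (steps xs)"
  by (induction xs rule: steps.induct) (auto simp: sym_def)

text \<open>Used to see that deleting a cycle leaves at most one edge at each of its vertices when
  all degrees are at most three.\<close>

lemma cycle_two_neighbours:
  assumes "zs \<noteq> []" and dist: "distinct (x # y # zs)" and "v \<in> set (x # y # zs)"
  shows "\<exists>a b. a \<noteq> b \<and> {a, b} \<subseteq> (steps (x # y # zs) \<union> edge (last zs) x) `` {v}"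
proof (cases "v = x")
  case True
  have "y \<noteq> last zs"
    using assms by auto
  then show ?thesis
    unfolding True by (intro exI[of _ y] exI[of _ "last zs"]) simp
next
  case False
  then obtain p r where pr: "y # zs = p @ v # r"
    using assms(3) by (metis set_ConsD split_list)
  let ?a = "last (x # p)" and ?b = "hd (r @ [x])"
  have *: "steps (x # y # zs) = steps (x # p) \<union> edge ?a v \<union> steps (v # r)"
    unfolding pr using steps_append[of "x # p" "v # r"] by simp
  have "(v, ?b) \<in> steps (x # y # zs) \<union> edge (last zs) x"
  proof (cases r)
    case Nil
    then have "last zs = v"
      using pr assms(1) by (metis last.simps last_snoc)
    then show ?thesis
      using Nil by simp
  next
    case (Cons w r')
    then show ?thesis
      unfolding * by simp
  qed
  moreover have "?a \<noteq> ?b"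
  proof (cases r)
    case Nil
    then have "p \<noteq> []"
      using pr assms(1) by auto
    then have "?a \<in> set (y # zs)"
      unfolding pr by simp
    then show ?thesis
      using dist Nil by auto
  next
    case (Cons w r')
    then have "distinct (x # p @ v # w # r')"
      using dist pr by simp
    moreover have "?a \<in> set (x # p)"
      by (rule last_in_set) simp
    ultimately show ?thesis
      using Cons by auto
  qed
  moreover have "(v, ?a) \<in> steps (x # y # zs)"
    unfolding * by simp
  ultimately show ?thesis
    by (intro exI[of _ ?a] exI[of _ ?b]) simp
qed

text \<open>Induction on the number of edges. An edge from a vertex \<open>u\<close> of degree at
  most two to some \<open>v\<close> is deleted and put back later: some colour is free at
  \<open>u\<close>, and if \<open>v\<close> has two edges of that colour, then the other colour is
  free at \<open>v\<close>. Without such an edge all degrees are zero or three, so as long as edges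
  remain there is a cycle to delete; its vertices keep at most one edge each, and
  \<open>linear_forests_add_cycle\<close> puts it back. Disjointness lets the edges of the two
  forests be counted separately later.\<close>

lemma two_linear_forests:
  assumes "finite V" and "E \<subseteq> V \<times> V" and "sym E" and "irrefl E" and "\<And>v. card (E `` {v}) \<le> 3"
  shows "\<exists>D. (\<forall>c. sym (D c) \<and> linear_forest V (D c)) \<and> E = D True \<union> D False \<and> D True \<inter> D False = {}"
  using assms(2-)
proof (induction "card E" arbitrary: E rule: less_induct)
  case less
  have "finite E"
    using less.prems(1) assms(1) finite_subset by blast
  then have fin: "finite (A `` {v})" if "A \<subseteq> E" for A v
    using that by (meson finite_Image finite_subset)
  have IH: "\<exists>D. (\<forall>c. sym (D c) \<and> linear_forest V (D c)) \<and> E - A = D True \<union> D False \<and> D True \<inter> D False = {}"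
    if "A \<noteq> {}" "A \<subseteq> E" "sym A" for A
  proof (rule less.hyps)
    show "card (E - A) < card E"
      using that \<open>finite E\<close> by (metis card_Diff_subset card_gt_0_iff card_mono diff_less finite_subset le_zero_eq neq0_conv)
    show "sym (E - A)"
      using less.prems(2) that(3) unfolding sym_def by blast
    show "card ((E - A) `` {v}) \<le> 3" for v
      using less.prems(4)[of v] card_mono[OF fin[of E v], of "(E - A) `` {v}"] by force
    show "irrefl (E - A)"
      using less.prems(3) unfolding irrefl_def by blast
  qed (use less.prems in blast)
  have few: "card ((E - A) `` {v}) \<le> k" if "card (E `` {v}) \<le> k + card B" "B \<subseteq> A `` {v}" "A \<subseteq> E" for A B v k
  proof -
    have "(E - A) `` {v} \<inter> B = {}" "(E - A) `` {v} \<union> B \<subseteq> E `` {v}"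
      using that by auto
    then have "card ((E - A) `` {v}) + card B \<le> card (E `` {v})"
      using fin by (metis card_Un_disjoint card_mono finite_Un finite_subset order_refl)
    then show ?thesis
      using that(1) by linarith
  qed
  have end_if: "end_vertex (E - A) v" if "card ((E - A) `` {v}) \<le> 1" for A v
  proof -
    have "\<forall>x\<in>(E - A) `` {v}. \<forall>y\<in>(E - A) `` {v}. x = y"
      using that fin[of "E - A" v] by (simp add: card_le_Suc0_iff_eq)
    then show ?thesis
      unfolding end_vertex_def by blast
  qed
  show ?case
  proof (cases "\<exists>u v. (u, v) \<in> E \<and> card (E `` {u}) \<le> 2")
    case True
    then obtain u v where uv: "(u, v) \<in> E" "card (E `` {u}) \<le> 2"
      by blast
    let ?A = "edge u v"
    have vu: "(v, u) \<in> E" "u \<noteq> v" "u \<in> V" "v \<in> V"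
      using uv(1) symD[OF less.prems(2) uv(1)] less.prems(1,3) by (auto simp: irrefl_def)
    then have A: "?A \<subseteq> E" "sym ?A"
      using uv sym_edge by auto
    then obtain D where D: "\<And>c. sym (D c)" "\<And>c. linear_forest V (D c)"
      "E - ?A = D True \<union> D False" "D True \<inter> D False = {}"
      using IH[OF insert_not_empty A] by (elim exE conjE) (use that in blast)
    have sub: "D c \<subseteq> E - ?A" for c
      using D(3) by (cases c) auto
    have disj: "D c \<inter> D (\<not> c) = {}" for c
      using D(4) by (cases c) auto
    have end_u: "end_vertex (E - ?A) u"
      using uv(2) A by (intro end_if few[where B = "{v}"]) auto
    have v2: "card ((E - ?A) `` {v}) \<le> 2"
      using less.prems(4)[of v] A by (intro few[where B = "{u}"]) auto
    obtain c where c: "u \<notin> Domain (D c)"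
    proof (cases "u \<in> Domain (D True)")
      case True
      then obtain w where "(u, w) \<in> D True"
        by blast
      then have "u \<notin> Domain (D False)"
        using end_u sub[of True] sub[of False] D(4) unfolding end_vertex_def by blast
      then show ?thesis
        using that by blast
    qed (use that in blast)
    have "\<exists>c. linear_forest V (D c \<union> ?A)"
    proof (cases "end_vertex (D c) v")
      case True
      then show ?thesis
        using linear_forest_insert_isolated[OF D(1,2) vu(3,4,2) c] by blast
    next
      case False
      then obtain x y where xy: "(v, x) \<in> D c" "(v, y) \<in> D c" "x \<noteq> y"
        unfolding end_vertex_def by blast
      have "{x, y} = (E - ?A) `` {v}"
        using xy sub[of c] v2 fin[of "E - ?A" v] by (intro card_seteq) auto
      have "(v, w) \<notin> D (\<not> c)" for w
      proof
        assume w: "(v, w) \<in> D (\<not> c)"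
        then have "w \<in> {x, y}"
          unfolding \<open>{x, y} = _\<close> using sub[of "\<not> c"] by auto
        then have "(v, w) \<in> D c"
          using xy by auto
        then show False
          using w disj[of c] by auto
      qed
      then have "v \<notin> Domain (D (\<not> c))"
        by blast
      moreover have "end_vertex (D (\<not> c)) u"
        using end_vertex_subset[OF end_u sub] .
      ultimately have "linear_forest V (D (\<not> c) \<union> edge v u)"
        using linear_forest_insert_isolated[OF D(1,2) vu(4,3)] vu(2) by blast
      then show ?thesis
        by (metis insert_commute)
    qed
    then obtain c where c: "linear_forest V (D c \<union> ?A)"
      by blast
    have "sym ((D(c := D c \<union> ?A)) c')" for c'
      using D(1) sym_Un[OF D(1) sym_edge[of u v]] by simp
    moreover have "linear_forest V ((D(c := D c \<union> ?A)) c')" for c'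
      using D(2) c by simp
    moreover have "E = (D(c := D c \<union> ?A)) True \<union> (D(c := D c \<union> ?A)) False"
      using D(3) A(1) by (cases c) auto
    moreover have "(D(c := D c \<union> ?A)) True \<inter> (D(c := D c \<union> ?A)) False = {}"
      using D(4) sub[of True] sub[of False] by (cases c) auto
    ultimately show ?thesis
      by (intro exI[of _ "D(c := D c \<union> ?A)"]) simp
  next
    case no_low: False
    show ?thesis
    proof (cases "E = {}")
      case True
      obtain xs where "distinct xs" "set xs = V"
        using finite_distinct_list[OF assms(1)] by blast
      then have "linear_forest V {}"
        unfolding linear_forest_def by blast
      then show ?thesis
        using True by (intro exI[of _ "\<lambda>_. {}"]) (simp add: sym_def)
    next
      case False
      have "\<not> end_vertex E u" if "(u, v) \<in> E" for u v
      proof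
        assume "end_vertex E u"
        then have "card (E `` {u}) \<le> 1"
          using fin[of E u] unfolding end_vertex_def by (simp add: card_le_Suc0_iff_eq)
        then show False
          using no_low that by fastforce
      qed
      then obtain x y zs where cyc: "zs \<noteq> []" "distinct (x # y # zs)"
        and A: "steps (x # y # zs) \<union> edge (last zs) x \<subseteq> E"
        using exists_cycle[OF assms(1) less.prems(1,2,3) False] by blast
      define A where "A = steps (x # y # zs) \<union> edge (last zs) x"
      have "sym A"
        unfolding A_def by (intro sym_Un sym_edge sym_steps)
      moreover have "A \<noteq> {}" "A \<subseteq> E"
        using A by (auto simp: A_def)
      ultimately have "\<exists>D. (\<forall>c. sym (D c) \<and> linear_forest V (D c)) \<and> E - A = D True \<union> D False \<and>
        D True \<inter> D False = {}"
        by (intro IH)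
      then obtain D where D: "\<And>c. sym (D c)" "\<And>c. linear_forest V (D c)"
        "E - A = D True \<union> D False" "D True \<inter> D False = {}"
        by (elim exE conjE) (use that in blast)
      have sub: "D c \<subseteq> E - A" for c
        using D(3) by (cases c) auto
      have ends: "end_vertex (E - A) v" if v: "v \<in> set (x # y # zs)" for v
      proof -
        obtain a b where "a \<noteq> b" "{a, b} \<subseteq> A `` {v}"
          using cycle_two_neighbours[OF cyc v] unfolding A_def by blast
        then show ?thesis
          using less.prems(4)[of v] \<open>A \<subseteq> E\<close> by (intro end_if few[where B = "{a, b}"]) auto
      qed
      \<comment> \<open>At most one edge remains at a cycle vertex, so \<open>False\<close> is free
        there whenever \<open>True\<close> is not.\<close>
      define s where "s v = (v \<notin> Domain (D True))" for v
      have iso: "v \<notin> Domain (D (s v))" if "v \<in> set (x # y # zs)" for v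
      proof (cases "v \<in> Domain (D True)")
        case True
        then obtain w where w: "(v, w) \<in> D True"
          by blast
        have "(v, w') \<notin> D False" for w'
          using ends[OF that] w sub[of True] sub[of False] D(4) unfolding end_vertex_def by blast
        then show ?thesis
          using True unfolding s_def by auto
      qed (simp add: s_def)
      have "set (x # y # zs) \<subseteq> V"
      proof
        fix v assume "v \<in> set (x # y # zs)"
        then obtain w where "(v, w) \<in> steps (x # y # zs) \<union> edge (last zs) x"
          using cycle_two_neighbours[OF cyc] by (metis Image_singleton_iff insert_subset)
        then show "v \<in> V"
          using A less.prems(1) by (metis SigmaD1 subset_iff)
      qed
      moreover have "end_vertex (D (\<not> s v)) v" if "v \<in> set (x # y # zs)" for v
        by (rule end_vertex_subset[OF ends[OF that] sub])
      ultimately have "\<exists>D'. (\<forall>c. sym (D' c) \<and> linear_forest V (D' c)) \<and>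
        D' True \<union> D' False = D True \<union> D False \<union> steps (x # y # zs) \<union> edge (last zs) x"
        by (intro linear_forests_add_cycle[OF D(1,2) cyc(2,1) _ iso])
      then obtain D' where D': "\<And>c. sym (D' c)" "\<And>c. linear_forest V (D' c)"
        "D' True \<union> D' False = D True \<union> D False \<union> steps (x # y # zs) \<union> edge (last zs) x"
        by (elim exE conjE) (use that in blast)
      have "E = D' True \<union> D' False"
        unfolding D'(3) using D(3) \<open>A \<subseteq> E\<close> unfolding A_def by blast
      \<comment> \<open>Removing the common edges from one forest restores disjointness, which
        \<open>linear_forests_add_cycle\<close> does not provide.\<close>
      moreover have "linear_forest V (D' False - D' True)"
        by (rule linear_forest_subset[OF D'(2)]) blast
      moreover have "sym (D' False - D' True)"
        using D'(1) unfolding sym_def by blast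
      ultimately show ?thesis
        using D'(1,2) by (intro exI[of _ "\<lambda>c. if c then D' True else D' False - D' True"]) auto
    qed
  qed
qed

section \<open>Drawing with two linear forests\<close>

lemma steps_nth:
  "(u, v) \<in> steps xs \<Longrightarrow>
    \<exists>i. Suc i < length xs \<and> (u = xs ! i \<and> v = xs ! Suc i \<or> v = xs ! i \<and> u = xs ! Suc i)"
proof (induction xs rule: steps.induct)
  case (1 x y zs)
  show ?case
  proof (cases "(u, v) \<in> steps (y # zs)")
    case True
    then obtain i where "Suc i < length (y # zs)"
      "u = (y # zs) ! i \<and> v = (y # zs) ! Suc i \<or> v = (y # zs) ! i \<and> u = (y # zs) ! Suc i"
      using 1 by blast
    then show ?thesis
      by (intro exI[of _ "Suc i"]) auto
  next
    case False
    then show ?thesis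
      using 1 by (intro exI[of _ 0]) auto
  qed
qed auto

lemma linear_forest_rank:
  assumes "linear_forest V R"
  shows "\<exists>r. inj_on r V \<and> r ` V \<subseteq> {..<card V} \<and> (\<forall>(u, v)\<in>R. r v = Suc (r u) \<or> r u = Suc (r v))"
proof -
  obtain xs where xs: "distinct xs" "set xs = V" "R \<subseteq> steps xs"
    using assms unfolding linear_forest_def by blast
  define r where "r = inv_into {..<length xs} ((!) xs)"
  have r: "r (xs ! i) = i" if "i < length xs" for i
    using that xs(1) unfolding r_def by (intro inv_into_f_f) (auto simp: inj_on_nth)
  have "inj_on r V"
  proof (rule inj_onI)
    fix u v assume "u \<in> V" "v \<in> V" "r u = r v"
    then show "u = v"
      using r unfolding xs(2)[symmetric] in_set_conv_nth by metis
  qed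
  moreover have "r ` V \<subseteq> {..<card V}"
    using r xs(1) unfolding xs(2)[symmetric] by (auto simp: in_set_conv_nth distinct_card)
  moreover have "r v = Suc (r u) \<or> r u = Suc (r v)" if "(u, v) \<in> R" for u v
    using steps_nth[of u v xs] that xs(3) r by (metis Suc_lessD subset_iff)
  ultimately show ?thesis
    by blast
qed

section \<open>The linear system for the gaps\<close>

text \<open>The solution is the least fixed point of the monotone operator \<open>T\<close> on the
  extended nonnegative reals. Smallness of \<open>d\<close> makes the constant function one a
  pre-fixed point, so the least fixed point is at most one and hence real.\<close>

lemma gap_system:
  fixes S :: "'i \<Rightarrow> 'i set" and d :: real
  assumes "0 \<le> d" and fin: "\<And>i. i \<in> Z \<Longrightarrow> finite (S i)"
    and small: "\<And>i. i \<in> Z \<Longrightarrow> d * card (S i) \<le> 1"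
  shows "\<exists>g. (\<forall>i. 0 \<le> g i) \<and> (\<forall>i\<in>Z. g i = d * (\<Sum>j\<in>S i. g j)) \<and> (\<forall>i. i \<notin> Z \<longrightarrow> g i = 1)"
proof -
  define T :: "('i \<Rightarrow> ennreal) \<Rightarrow> 'i \<Rightarrow> ennreal" where
    "T g i = (if i \<in> Z then ennreal d * (\<Sum>j\<in>S i. g j) else 1)" for g i
  have "mono T"
    by (auto simp: T_def mono_def le_fun_def intro!: mult_left_mono sum_mono)
  have "T (\<lambda>_. 1) \<le> (\<lambda>_. 1)"
  proof (rule le_funI)
    fix i
    show "T (\<lambda>_. 1) i \<le> 1"
    proof (cases "i \<in> Z")
      case True
      have "T (\<lambda>_. 1) i = ennreal (d * card (S i))"
        using True \<open>0 \<le> d\<close> by (simp add: T_def ennreal_mult ennreal_of_nat_eq_real_of_nat)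
      then show ?thesis
        using small[OF True] by (metis ennreal_1 ennreal_leI)
    qed (simp add: T_def)
  qed
  then have "lfp T \<le> (\<lambda>_. 1)"
    by (rule lfp_lowerbound)
  then have "lfp T i \<noteq> top" for i
    by (metis ennreal_one_neq_top le_fun_def top.extremum_uniqueI)
  then have lfp: "lfp T i = ennreal (enn2real (lfp T i))" for i
    by (metis ennreal_enn2real top.not_eq_extremum)
  define g where "g i = enn2real (lfp T i)" for i
  have unfold: "ennreal (g i) = T (\<lambda>j. ennreal (g j)) i" for i
    unfolding g_def lfp[symmetric] by (rule fun_cong[OF lfp_unfold[OF \<open>mono T\<close>]])
  have g: "0 \<le> g i" for i
    by (simp add: g_def)
  have "g i = d * (\<Sum>j\<in>S i. g j)" if "i \<in> Z" for i
  proof -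
    have "ennreal (g i) = ennreal (d * (\<Sum>j\<in>S i. g j))"
      using unfold[of i] that g \<open>0 \<le> d\<close> by (simp add: T_def sum_ennreal ennreal_mult sum_nonneg)
    then show ?thesis
      using g \<open>0 \<le> d\<close> by (simp add: sum_nonneg)
  qed
  moreover have "g i = 1" if "i \<notin> Z" for i
    using unfold[of i] that g by (simp add: T_def)
  ultimately show ?thesis
    using g by blast
qed

text \<open>One of the two intervals is empty; their union collects the gaps between the two
  positions in whichever order these come.\<close>

lemma abs_diff_partial_sums:
  fixes g :: "nat \<Rightarrow> real"
  assumes "\<And>i. 0 \<le> g i"
  shows "\<bar>sum g {..<m} - sum g {..<k}\<bar> = sum g ({m..<k} \<union> {k..<m})"
proof -
  have "\<bar>sum g {..<m} - sum g {..<k}\<bar> = sum g ({m..<k} \<union> {k..<m})" if "m \<le> k" for m k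
  proof -
    have "{..<k} = {..<m} \<union> {m..<k}"
      using that by auto
    then have "sum g {..<k} = sum g {..<m} + sum g {m..<k}"
      by (simp add: sum.union_disjoint ivl_disj_int)
    then show ?thesis
      using that assms by (simp add: sum_nonneg)
  qed
  then show ?thesis
    using nat_le_linear[of m k] by (metis abs_minus_commute sup_commute)
qed

text \<open>The gaps on the two axes solve one linear fixed point system, indexed by \<open>nat + nat\<close>.\<close>

lemma gaps_exist:
  fixes r q :: "'a \<Rightarrow> nat" and d :: real
  assumes r: "inj_on r V" "r ` V \<subseteq> {..<n}" and q: "inj_on q V" "q ` V \<subseteq> {..<n}"
    and F: "F \<subseteq> V \<times> V" "\<forall>(u, v)\<in>F. r v = Suc (r u) \<or> r u = Suc (r v)"
    and H: "H \<subseteq> V \<times> V" "\<forall>(u, v)\<in>H. q v = Suc (q u) \<or> q u = Suc (q v)"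
    and "0 \<le> d" and d: "d * n \<le> 1"
  obtains g h :: "nat \<Rightarrow> real" where "\<And>i. 0 \<le> g i" and "\<And>i. 0 \<le> h i"
    and "\<And>i. g i = 1 \<or> (\<exists>u v. (u, v) \<in> F \<union> F\<inverse> \<and> r u = i \<and> r v = Suc i)"
    and "\<And>i. h i = 1 \<or> (\<exists>u v. (u, v) \<in> H \<union> H\<inverse> \<and> q u = i \<and> q v = Suc i)"
    and "\<And>u v. (u, v) \<in> F \<Longrightarrow>
      \<bar>sum g {..<r u} - sum g {..<r v}\<bar> = d * \<bar>sum h {..<q u} - sum h {..<q v}\<bar>"
    and "\<And>u v. (u, v) \<in> H \<Longrightarrow>
      \<bar>sum h {..<q u} - sum h {..<q v}\<bar> = d * \<bar>sum g {..<r u} - sum g {..<r v}\<bar>"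
proof -
  define between :: "nat \<Rightarrow> nat \<Rightarrow> nat set" where "between m k = {m..<k} \<union> {k..<m}" for m k
  have between_commute: "between m k = between k m" for m k
    by (auto simp: between_def)
  \<comment> \<open>The positions whose step to the next position is an edge. Only their gaps are
    subject to an equation; all other gaps are one.\<close>
  define Zr where "Zr = {r u |u v. (u, v) \<in> F \<union> F\<inverse> \<and> r v = Suc (r u)}"
  define Zq where "Zq = {q u |u v. (u, v) \<in> H \<union> H\<inverse> \<and> q v = Suc (q u)}"
  define ri qi where "ri = inv_into V r" and "qi = inv_into V q"
  \<comment> \<open>\<open>Inl\<close> marks the gaps along \<open>r\<close> and \<open>Inr\<close>
    those along \<open>q\<close>. The gap of an edge step of one kind is governed by the gaps of the
    other kind between its two ends, and these number at most \<open>n\<close>.\<close>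
  define S :: "nat + nat \<Rightarrow> (nat + nat) set" where
    "S = case_sum (\<lambda>i. Inr ` between (q (ri i)) (q (ri (Suc i)))) (\<lambda>i. Inl ` between (r (qi i)) (r (qi (Suc i))))"
  have inv: "ri (r v) = v" "qi (q v) = v" if "v \<in> V" for v
    using that r q by (simp_all add: ri_def qi_def)
  have card_between: "card (between m k) \<le> n" "finite (between m k)" if "m < n" "k < n" for m k
  proof -
    have "between m k \<subseteq> {..<n}"
      using that by (auto simp: between_def)
    then show "card (between m k) \<le> n"
      by (metis card_lessThan card_mono finite_lessThan)
  qed (simp add: between_def)
  have S_Inl: "S (Inl i) = Inr ` between (q u) (q v)"
    if "(u, v) \<in> F \<union> F\<inverse>" "r v = Suc (r u)" "i = r u" for i u v
  proof -
    have "u \<in> V" "v \<in> V"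
      using that F by auto
    then show ?thesis
      using inv(1)[of u] inv(1)[of v] that by (simp add: S_def)
  qed
  have S_Inr: "S (Inr i) = Inl ` between (r u) (r v)"
    if "(u, v) \<in> H \<union> H\<inverse>" "q v = Suc (q u)" "i = q u" for i u v
  proof -
    have "u \<in> V" "v \<in> V"
      using that H by auto
    then show ?thesis
      using inv(2)[of u] inv(2)[of v] that by (simp add: S_def)
  qed
  have S: "finite (S i) \<and> card (S i) \<le> n" if i: "i \<in> Inl ` Zr \<union> Inr ` Zq" for i
  proof -
    consider u v where "(u, v) \<in> F \<union> F\<inverse>" "r v = Suc (r u)" "i = Inl (r u)"
      | u v where "(u, v) \<in> H \<union> H\<inverse>" "q v = Suc (q u)" "i = Inr (q u)"
      using i unfolding Zr_def Zq_def by blast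
    then show ?thesis
    proof cases
      case 1
      then have "q u < n" "q v < n"
        using F(1) q(2) by auto
      then show ?thesis
        using 1 S_Inl[OF 1(1,2) refl] card_between[of "q u" "q v"] by (simp add: card_image)
    next
      case 2
      then have "r u < n" "r v < n"
        using H(1) r(2) by auto
      then show ?thesis
        using 2 S_Inr[OF 2(1,2) refl] card_between[of "r u" "r v"] by (simp add: card_image)
    qed
  qed
  have "d * card (S i) \<le> 1" if "i \<in> Inl ` Zr \<union> Inr ` Zq" for i
    using S[OF that] \<open>0 \<le> d\<close> d by (meson mult_left_mono of_nat_mono order_trans)
  then have "\<exists>gh. (\<forall>i. 0 \<le> gh i) \<and> (\<forall>i\<in>Inl ` Zr \<union> Inr ` Zq. gh i = d * (\<Sum>j\<in>S i. gh j)) \<and>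
    (\<forall>i. i \<notin> Inl ` Zr \<union> Inr ` Zq \<longrightarrow> gh i = 1)"
    using S by (intro gap_system \<open>0 \<le> d\<close>) simp_all
  then obtain gh where "\<forall>i. 0 \<le> gh i"
    "\<forall>i\<in>Inl ` Zr \<union> Inr ` Zq. gh i = d * (\<Sum>j\<in>S i. gh j)"
    "\<forall>i. i \<notin> Inl ` Zr \<union> Inr ` Zq \<longrightarrow> gh i = 1"
    by (elim exE conjE)
  note gh = this[rule_format]
  define g h where "g i = gh (Inl i)" and "h i = gh (Inr i)" for i
  have pos: "0 \<le> g i" "0 \<le> h i" for i
    using gh(1) by (simp_all add: g_def h_def)
  have g_step: "\<bar>sum g {..<r u} - sum g {..<r v}\<bar> = d * \<bar>sum h {..<q u} - sum h {..<q v}\<bar>"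
    if "(u, v) \<in> F \<union> F\<inverse>" "r v = Suc (r u)" for u v
  proof -
    have "r u \<in> Zr"
      using that unfolding Zr_def by blast
    then have "g (r u) = d * sum h (between (q u) (q v))"
      using gh(2)[of "Inl (r u)"] S_Inl[OF that refl] by (simp add: g_def h_def sum.reindex)
    then show ?thesis
      using pos that(2) abs_diff_partial_sums[of h "q u" "q v"] \<open>0 \<le> d\<close>
      by (simp add: between_def abs_mult sum_nonneg)
  qed
  have h_step: "\<bar>sum h {..<q u} - sum h {..<q v}\<bar> = d * \<bar>sum g {..<r u} - sum g {..<r v}\<bar>"
    if "(u, v) \<in> H \<union> H\<inverse>" "q v = Suc (q u)" for u v
  proof -
    have "q u \<in> Zq"
      using that unfolding Zq_def by blast
    then have "h (q u) = d * sum g (between (r u) (r v))"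
      using gh(2)[of "Inr (q u)"] S_Inr[OF that refl] by (simp add: g_def h_def sum.reindex)
    then show ?thesis
      using pos that(2) abs_diff_partial_sums[of g "r u" "r v"] \<open>0 \<le> d\<close>
      by (simp add: between_def abs_mult sum_nonneg)
  qed
  show ?thesis
  proof (rule that[of g h])
    show "g i = 1 \<or> (\<exists>u v. (u, v) \<in> F \<union> F\<inverse> \<and> r u = i \<and> r v = Suc i)" for i
      using gh(3)[of "Inl i"] unfolding g_def Zr_def by blast
    show "h i = 1 \<or> (\<exists>u v. (u, v) \<in> H \<union> H\<inverse> \<and> q u = i \<and> q v = Suc i)" for i
      using gh(3)[of "Inr i"] unfolding h_def Zq_def by blast
    show "\<bar>sum g {..<r u} - sum g {..<r v}\<bar> = d * \<bar>sum h {..<q u} - sum h {..<q v}\<bar>"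
      if "(u, v) \<in> F" for u v
      using that F(2) g_step[of u v] g_step[of v u] by (auto simp: abs_minus_commute)
    show "\<bar>sum h {..<q u} - sum h {..<q v}\<bar> = d * \<bar>sum g {..<r u} - sum g {..<r v}\<bar>"
      if "(u, v) \<in> H" for u v
      using that H(2) h_step[of u v] h_step[of v u] by (auto simp: abs_minus_commute)
  qed (use pos in auto)
qed

section \<open>Vertices drawn at the same point\<close>

text \<open>Let \<open>m\<close> have the largest rank in \<open>W\<close>, and let \<open>v\<close>
  be another element. As \<open>Y\<close> is monotone in the rank and agrees at \<open>v\<close> and
  \<open>m\<close>, the gap after \<open>v\<close> is zero, so the step to the next vertex is an
  edge of \<open>F\<close>. It has height zero, hence width zero as \<open>d\<close> is positive,
  and so the next vertex is in \<open>W\<close> again. This gives \<open>card W - 1\<close> edges,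
  each counted in both directions.\<close>

lemma card_edges_of_coincident_vertices:
  fixes r :: "'a \<Rightarrow> nat" and g :: "nat \<Rightarrow> real" and X :: "'a \<Rightarrow> real"
  defines "Y v \<equiv> sum g {..<r v}"
  assumes "finite V" and "inj_on r V" and "F \<subseteq> V \<times> V" and "sym F" and g: "\<And>i. 0 \<le> g i"
    and steps: "\<And>i. g i = 1 \<or> (\<exists>u v. (u, v) \<in> F \<union> F\<inverse> \<and> r u = i \<and> r v = Suc i)"
    and edges: "\<And>u v. (u, v) \<in> F \<Longrightarrow> \<bar>Y u - Y v\<bar> = d * \<bar>X u - X v\<bar>"
    and "0 < d" and W: "W = {w \<in> V. X w = a \<and> Y w = b}"
  shows "2 * (card W - 1) \<le> card (F \<inter> W \<times> W)"
proof (cases "W = {}")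
  case False
  have "finite W"
    using W \<open>finite V\<close> by simp
  have "Max (r ` W) \<in> r ` W"
    using False \<open>finite W\<close> by simp
  then obtain m where "m \<in> W" "r m = Max (r ` W)"
    by auto
  then have m: "m \<in> W" "\<And>w. w \<in> W \<Longrightarrow> r w \<le> r m"
    using \<open>finite W\<close> by auto
  have Y_Suc: "Y v' = Y v + g (r v)" if "r v' = Suc (r v)" for v v'
    using that by (simp add: Y_def)
  have "\<exists>v'. (v, v') \<in> F \<and> v' \<in> W \<and> r v < r v'" if v: "v \<in> W - {m}" for v
  proof -
    have "r v < r m"
      using v m W \<open>inj_on r V\<close> by (metis (mono_tags, lifting) DiffE inj_onD insertI1 le_neq_implies_less mem_Collect_eq)
    then have "Y v + g (r v) \<le> Y m"
      using sum_mono2[of "{..<r m}" "{..<Suc (r v)}" g] g by (simp add: Y_def)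
    moreover have "Y m = Y v"
      using v m W by auto
    ultimately have zero: "g (r v) = 0"
      using g[of "r v"] by linarith
    then obtain u v' where uv: "(u, v') \<in> F" "r u = r v" "r v' = Suc (r v)"
      using steps[of "r v"] \<open>sym F\<close> by (auto dest: symD)
    then have "u = v"
      using v W \<open>inj_on r V\<close> \<open>F \<subseteq> V \<times> V\<close> by (auto dest: inj_onD)
    then have "Y v' = Y v" "X v' = X v"
      using edges[OF uv(1)] Y_Suc[OF uv(3)] zero \<open>0 < d\<close> by auto
    then have "v' \<in> W"
      using uv(1) v W \<open>F \<subseteq> V \<times> V\<close> by auto
    then show ?thesis
      using uv \<open>u = v\<close> by auto
  qed
  then obtain nxt where nxt: "\<And>v. v \<in> W - {m} \<Longrightarrow> (v, nxt v) \<in> F \<and> nxt v \<in> W \<and> r v < r (nxt v)"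
    by metis
  let ?up = "(\<lambda>v. (v, nxt v)) ` (W - {m})" and ?down = "(\<lambda>v. (nxt v, v)) ` (W - {m})"
  have "card ?up = card W - 1" "card ?down = card W - 1"
    using m(1) \<open>finite W\<close> by (subst card_image; auto simp: inj_on_def)+
  moreover have "?up \<inter> ?down = {}"
  proof (rule equals0I)
    fix e assume "e \<in> ?up \<inter> ?down"
    then obtain v w where "v \<in> W - {m}" "w \<in> W - {m}" "e = (v, nxt v)" "e = (nxt w, w)"
      by blast
    then show False
      using nxt[of v] nxt[of w] by (metis Pair_inject less_asym)
  qed
  moreover have "?up \<union> ?down \<subseteq> F \<inter> W \<times> W"
    using nxt symD[OF \<open>sym F\<close>] by blast
  ultimately show ?thesis
    using card_mono[of "F \<inter> W \<times> W" "?up \<union> ?down"] \<open>finite W\<close> by (simp add: card_Un_disjoint)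
qed simp

text \<open>Stated for a plain relation and a prescribed set \<open>S\<close> of slopes, so that
  drawings of disjoint parts can be assembled without new slopes.\<close>

definition drawing :: "real option set \<Rightarrow> 'a set \<Rightarrow> ('a \<times> 'a) set \<Rightarrow> ('a \<Rightarrow> real \<times> real) \<Rightarrow> bool" where
  "drawing S V E p \<longleftrightarrow> inj_on p V \<and>
     (\<forall>(u, v)\<in>E. slope (p u) (p v) \<in> S \<and> (\<forall>w\<in>V - {u, v}. p w \<notin> closed_segment (p u) (p v)))"

lemma real_segment_between:
  "(z :: real) \<in> closed_segment x y \<Longrightarrow> min x y \<le> z \<and> z \<le> max x y"
  by (auto simp: closed_segment_eq_real_ivl split: if_splits)

lemma sum_strict_mono_index:
  fixes g :: "nat \<Rightarrow> real"
  assumes "\<And>i. 0 < g i"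
  shows "strict_mono (\<lambda>k. sum g {..<k})"
  using assms by (intro strict_mono_Suc_iff[THEN iffD2]) simp

text \<open>Positive gaps make the coordinate strictly increasing in the rank, and no third rank
  lies between two consecutive ones.\<close>

lemma rank_not_between:
  fixes r :: "'a \<Rightarrow> nat" and g :: "nat \<Rightarrow> real"
  assumes "inj_on r V" and "u \<in> V" "v \<in> V" "w \<in> V" and "w \<noteq> u" "w \<noteq> v"
    and "r v = Suc (r u) \<or> r u = Suc (r v)" and "\<And>i. 0 < g i"
  shows "sum g {..<r w} \<notin> closed_segment (sum g {..<r u}) (sum g {..<r v})"
proof
  let ?Y = "\<lambda>k. sum g {..<k}"
  assume "?Y (r w) \<in> closed_segment (?Y (r u)) (?Y (r v))"
  then have "min (?Y (r u)) (?Y (r v)) \<le> ?Y (r w)" "?Y (r w) \<le> max (?Y (r u)) (?Y (r v))"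
    using real_segment_between by blast+
  then have "min (r u) (r v) \<le> r w" "r w \<le> max (r u) (r v)"
    using strict_mono_less_eq[OF sum_strict_mono_index[of g]] assms(8)
    unfolding min_le_iff_disj le_max_iff_disj by auto
  then have "r w = r u \<or> r w = r v"
    using assms(7) by linarith
  then show False
    using assms by (auto dest: inj_onD)
qed

lemma slope_cases:
  assumes "fst P \<noteq> fst Q" and "\<bar>snd P - snd Q\<bar> = m * \<bar>fst P - fst Q\<bar>"
  shows "slope P Q \<in> {Some m, Some (- m)}"
proof -
  have "snd Q - snd P = m * (fst Q - fst P) \<or> snd Q - snd P = - m * (fst Q - fst P)"
    using assms(2) by (auto simp: abs_if algebra_simps split: if_splits)
  then show ?thesis
    using assms(1) by (auto simp: slope_def field_simps)
qed

text \<open>Write \<open>k\<close> for \<open>card W\<close> and count ordered pairs: the degree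
  bound allows at most \<open>3 * k\<close> and looplessness at most \<open>k * (k - 1)\<close>.
  Against \<open>4 * (k - 1)\<close> the first forces \<open>k \<le> 4\<close> and the second
  \<open>k \<ge> 4\<close>; for \<open>k = 4\<close> all twelve pairs must be present.\<close>

lemma four_clique_if_many_edges:
  assumes "finite W" and "2 \<le> card W" and "irrefl E" and "finite E" and "\<And>v. card (E `` {v}) \<le> 3"
    and many: "4 * (card W - 1) \<le> card (E \<inter> W \<times> W)"
  shows "card W = 4 \<and> (\<forall>u\<in>W. \<forall>v\<in>W. u \<noteq> v \<longrightarrow> (u, v) \<in> E)"
proof -
  let ?k = "card W"
  have "E \<inter> W \<times> W = Sigma W (\<lambda>v. E `` {v} \<inter> W)"
    by auto
  then have card: "card (E \<inter> W \<times> W) = (\<Sum>v\<in>W. card (E `` {v} \<inter> W))"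
    using \<open>finite W\<close> by simp
  have "card (E `` {v} \<inter> W) \<le> 3" for v
    using assms(5)[of v] card_mono[of "E `` {v}" "E `` {v} \<inter> W"] \<open>finite E\<close>
    by (meson Int_lower1 finite_Image order_trans)
  then have "card (E \<inter> W \<times> W) \<le> ?k * 3"
    unfolding card using sum_bounded_above[of W "\<lambda>v. card (E `` {v} \<inter> W)" 3] by simp
  moreover have "card (E `` {v} \<inter> W) \<le> ?k - 1" if "v \<in> W" for v
  proof -
    have "E `` {v} \<inter> W \<subseteq> W - {v}"
      using \<open>irrefl E\<close> by (auto simp: irrefl_def)
    then show ?thesis
      using that \<open>finite W\<close> card_mono[of "W - {v}" "E `` {v} \<inter> W"] by simp
  qed
  then have "card (E \<inter> W \<times> W) \<le> ?k * (?k - 1)"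
    unfolding card using sum_bounded_above[of W "\<lambda>v. card (E `` {v} \<inter> W)" "?k - 1"] by simp
  then have "4 * (?k - 1) \<le> ?k * (?k - 1)"
    using many by linarith
  then have "4 \<le> ?k"
    using \<open>2 \<le> ?k\<close> by simp
  ultimately have k: "?k = 4"
    using many by linarith
  have "E \<inter> W \<times> W \<subseteq> W \<times> W - Id_on W"
    using \<open>irrefl E\<close> by (auto simp: irrefl_def)
  moreover have "card (W \<times> W - Id_on W) = 12"
  proof -
    have "Id_on W = (\<lambda>v. (v, v)) ` W"
      by auto
    then have "card (Id_on W) = 4"
      using k by (simp add: card_image inj_on_def)
    then show ?thesis
      using k \<open>finite W\<close> by (subst card_Diff_subset) (auto simp: card_cartesian_product \<open>Id_on W = _\<close>)
  qed
  ultimately have "E \<inter> W \<times> W = W \<times> W - Id_on W"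
    using many k \<open>finite W\<close> by (intro card_seteq) auto
  then have "(u, v) \<in> E" if "u \<in> W" "v \<in> W" "u \<noteq> v" for u v
    using that by blast
  then show ?thesis
    using k by blast
qed

lemma drawing_without_four_clique:
  fixes d :: real
  assumes "finite V" and "E \<subseteq> V \<times> V" and "sym E" and "irrefl E" and deg: "\<And>v. card (E `` {v}) \<le> 3"
    and no_clique: "\<And>W. W \<subseteq> V \<Longrightarrow> card W = 4 \<Longrightarrow> \<exists>u\<in>W. \<exists>v\<in>W. u \<noteq> v \<and> (u, v) \<notin> E"
    and "0 < d" and "d * card V \<le> 1"
  shows "\<exists>p. drawing {Some d, Some (- d), Some (1 / d), Some (- (1 / d))} V E p"
proof -
  obtain D where D: "\<forall>c. sym (D c) \<and> linear_forest V (D c)"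
    "E = D True \<union> D False" "D True \<inter> D False = {}"
    using two_linear_forests[OF assms(1-5)] by (elim exE conjE)
  define F H where "F = D True" and "H = D False"
  have FH: "sym F" "sym H" "E = F \<union> H" "F \<inter> H = {}"
    using D by (simp_all add: F_def H_def)
  then have sub: "F \<subseteq> V \<times> V" "H \<subseteq> V \<times> V"
    using \<open>E \<subseteq> V \<times> V\<close> by simp_all
  have lin: "linear_forest V F" "linear_forest V H"
    using D(1) by (simp_all add: F_def H_def)
  obtain r where r: "inj_on r V" "r ` V \<subseteq> {..<card V}" "\<forall>(u, v)\<in>F. r v = Suc (r u) \<or> r u = Suc (r v)"
    using linear_forest_rank[OF lin(1)] by (elim exE conjE)
  obtain q where q: "inj_on q V" "q ` V \<subseteq> {..<card V}" "\<forall>(u, v)\<in>H. q v = Suc (q u) \<or> q u = Suc (q v)"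
    using linear_forest_rank[OF lin(2)] by (elim exE conjE)
  obtain g h :: "nat \<Rightarrow> real" where nonneg: "\<And>i. 0 \<le> g i" "\<And>i. 0 \<le> h i"
    and g: "\<And>i. g i = 1 \<or> (\<exists>u v. (u, v) \<in> F \<union> F\<inverse> \<and> r u = i \<and> r v = Suc i)"
    and h: "\<And>i. h i = 1 \<or> (\<exists>u v. (u, v) \<in> H \<union> H\<inverse> \<and> q u = i \<and> q v = Suc i)"
    and F: "\<And>u v. (u, v) \<in> F \<Longrightarrow>
      \<bar>sum g {..<r u} - sum g {..<r v}\<bar> = d * \<bar>sum h {..<q u} - sum h {..<q v}\<bar>"
    and H: "\<And>u v. (u, v) \<in> H \<Longrightarrow>
      \<bar>sum h {..<q u} - sum h {..<q v}\<bar> = d * \<bar>sum g {..<r u} - sum g {..<r v}\<bar>"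
    by (rule gaps_exist[OF r(1,2) q(1,2) sub(1) r(3) sub(2) q(3) less_imp_le[OF \<open>0 < d\<close>] \<open>d * card V \<le> 1\<close>], rule that)
  define X Y where "X v = sum h {..<q v}" and "Y v = sum g {..<r v}" for v
  have edgeF: "\<bar>Y u - Y v\<bar> = d * \<bar>X u - X v\<bar>" if "(u, v) \<in> F" for u v
    using F[OF that] by (simp add: X_def Y_def)
  have edgeH: "\<bar>X u - X v\<bar> = d * \<bar>Y u - Y v\<bar>" if "(u, v) \<in> H" for u v
    using H[OF that] by (simp add: X_def Y_def)
  \<comment> \<open>If the ends of an edge coincided, the set \<open>W\<close> of all vertices at
    that point would carry at least \<open>2 * (card W - 1)\<close> ordered pairs from each forest
    and hence be a four-clique.\<close>
  have distinct: "\<not> (X u = X v \<and> Y u = Y v)" if "(u, v) \<in> E" for u v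
  proof
    assume eq: "X u = X v \<and> Y u = Y v"
    define W where "W = {w \<in> V. X w = X u \<and> Y w = Y u}"
    have W': "W = {w \<in> V. Y w = Y u \<and> X w = X u}"
      by (auto simp: W_def)
    have "2 * (card W - 1) \<le> card (F \<inter> W \<times> W)"
      using edgeF W_def unfolding X_def Y_def
      by (intro card_edges_of_coincident_vertices[OF \<open>finite V\<close> r(1) sub(1) FH(1) nonneg(1) g _ \<open>0 < d\<close>])
    \<comment> \<open>The same lemma with the two axes exchanged.\<close>
    moreover have "2 * (card W - 1) \<le> card (H \<inter> W \<times> W)"
      using edgeH W' unfolding X_def Y_def
      by (intro card_edges_of_coincident_vertices[OF \<open>finite V\<close> q(1) sub(2) FH(2) nonneg(2) h _ \<open>0 < d\<close>])
    moreover have finE: "finite E"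
      using assms(1,2) finite_subset by blast
    then have "card (E \<inter> W \<times> W) = card (F \<inter> W \<times> W) + card (H \<inter> W \<times> W)"
      unfolding \<open>E = F \<union> H\<close> using FH(4) by (subst card_Un_disjoint[symmetric]) (auto simp: Int_Un_distrib2)
    ultimately have "4 * (card W - 1) \<le> card (E \<inter> W \<times> W)"
      by linarith
    moreover have "{u, v} \<subseteq> W" "u \<noteq> v"
      using that eq \<open>E \<subseteq> V \<times> V\<close> \<open>irrefl E\<close> by (auto simp: W_def irrefl_def)
    then have "2 \<le> card W"
      using card_mono[of W "{u, v}"] \<open>finite V\<close> by (simp add: W_def)
    moreover have "finite W" "W \<subseteq> V"
      using \<open>finite V\<close> by (auto simp: W_def)
    ultimately show False
      using four_clique_if_many_edges[of W E] \<open>irrefl E\<close> finE deg no_clique[of W] by blast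
  qed
  \<comment> \<open>On an edge, the two coordinate differences are proportional with a positive
    factor, so equality in one coordinate would force equality in both.\<close>
  have neq: "X u \<noteq> X v" "Y u \<noteq> Y v" if "(u, v) \<in> E" for u v
    using that distinct[OF that] edgeF[of u v] edgeH[of u v] \<open>0 < d\<close> \<open>E = F \<union> H\<close> by auto
  \<comment> \<open>A zero gap would belong to an edge, whose ends would then have the same
    ordinate.\<close>
  have gpos: "0 < g i" for i
  proof (rule ccontr)
    assume "\<not> 0 < g i"
    then have "g i = 0"
      using nonneg(1)[of i] by simp
    then obtain u v where "(u, v) \<in> E" "r u = i" "r v = Suc i"
      using g[of i] FH(3) symD[OF FH(1)] by auto
    then show False
      using neq(2)[of u v] \<open>g i = 0\<close> by (simp add: Y_def)
  qed
  have hpos: "0 < h i" for i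
  proof (rule ccontr)
    assume "\<not> 0 < h i"
    then have "h i = 0"
      using nonneg(2)[of i] by simp
    then obtain u v where "(u, v) \<in> E" "q u = i" "q v = Suc i"
      using h[of i] FH(3) symD[OF FH(2)] by auto
    then show False
      using neq(1)[of u v] \<open>h i = 0\<close> by (simp add: X_def)
  qed
  define p where "p v = (X v, Y v)" for v
  have "inj_on p V"
  proof (rule inj_onI)
    fix u v assume "u \<in> V" "v \<in> V" "p u = p v"
    then have "sum g {..<r u} = sum g {..<r v}"
      by (simp add: p_def Y_def)
    then have "r u = r v"
      using strict_mono_eq[OF sum_strict_mono_index[of g]] gpos by blast
    then show "u = v"
      using r(1) \<open>u \<in> V\<close> \<open>v \<in> V\<close> by (auto dest: inj_onD)
  qed
  moreover have "slope (p u) (p v) \<in> {Some d, Some (- d), Some (1 / d), Some (- (1 / d))}"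
    if uv: "(u, v) \<in> E" for u v
  proof (cases "(u, v) \<in> F")
    case True
    then show ?thesis
      using slope_cases[of "p u" "p v" d] neq(1)[OF uv] edgeF[OF True] unfolding p_def by auto
  next
    case False
    then have "(u, v) \<in> H"
      using uv FH(3) by blast
    then have "\<bar>Y u - Y v\<bar> = 1 / d * \<bar>X u - X v\<bar>"
      using edgeH[of u v] \<open>0 < d\<close> by (simp add: field_simps)
    then show ?thesis
      using slope_cases[of "p u" "p v" "1 / d"] neq(1)[OF uv] unfolding p_def by auto
  qed
  moreover have "p w \<notin> closed_segment (p u) (p v)" if uv: "(u, v) \<in> E" and w: "w \<in> V - {u, v}" for u v w
  proof
    assume "p w \<in> closed_segment (p u) (p v)"
    then have seg: "X w \<in> closed_segment (X u) (X v)" "Y w \<in> closed_segment (Y u) (Y v)"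
      unfolding p_def by (auto dest: closed_segment_PairD)
    have V: "u \<in> V" "v \<in> V" "w \<in> V" "w \<noteq> u" "w \<noteq> v"
      using uv w \<open>E \<subseteq> V \<times> V\<close> by auto
    \<comment> \<open>An edge of \<open>F\<close> joins consecutive ranks under \<open>r\<close>, so
      the ordinate excludes \<open>w\<close>; for an edge of \<open>H\<close> the abscissa
      does.\<close>
    show False
    proof (cases "(u, v) \<in> F")
      case True
      then have "r v = Suc (r u) \<or> r u = Suc (r v)"
        using r(3) by auto
      then show ?thesis
        using rank_not_between[OF r(1) V, of g] gpos seg(2) by (simp add: Y_def)
    next
      case False
      then have "q v = Suc (q u) \<or> q u = Suc (q v)"
        using q(3) uv FH(3) by auto
      then show ?thesis
        using rank_not_between[OF q(1) V, of h] hpos seg(1) by (simp add: X_def)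
    qed
  qed
  ultimately show ?thesis
    unfolding drawing_def by (intro exI[of _ p]) blast
qed

section \<open>Components that are complete on four vertices\<close>

lemma slope_eqI:
  "fst P \<noteq> fst Q \<Longrightarrow> snd Q - snd P = m * (fst Q - fst P) \<Longrightarrow> slope P Q = Some m"
  by (simp add: slope_def)

text \<open>Collinearity written as a cross product, a form that a nonzero determinant
  refutes.\<close>

lemma segment_cross_product:
  fixes u v w :: "real \<times> real"
  assumes "w \<in> closed_segment u v"
  shows "(fst w - fst u) * (snd v - snd u) = (snd w - snd u) * (fst v - fst u)"
proof -
  obtain t where w: "w = (1 - t) *\<^sub>R u + t *\<^sub>R v"
    using assms unfolding closed_segment_def by blast
  have "fst w - fst u = t * (fst v - fst u)" "snd w - snd u = t * (snd v - snd u)"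
    unfolding w by (simp_all add: algebra_simps)
  then show ?thesis
    by simp
qed

text \<open>The vectors \<open>a\<close>, \<open>b\<close> of slopes \<open>d\<close>, \<open>- d\<close> are scaled so that \<open>a + b\<close> has slope \<open>1 / d\<close>;
  then \<open>a - b\<close> has slope \<open>d ^ 3\<close>.\<close>

lemma four_clique_drawing:
  fixes d c :: real
  assumes "card W = 4" and "0 < d" "d < 1" and "irrefl E" and "E \<subseteq> W \<times> W"
  shows "\<exists>p. drawing {Some d, Some (- d), Some (1 / d), Some (- (1 / d)), Some (d ^ 3)} W E p \<and> (\<forall>v\<in>W. c < fst (p v))"
proof -
  \<comment> \<open>The factors \<open>1 + d ^ 2\<close> and \<open>1 - d ^ 2\<close> give
    \<open>a + b = (2 * d ^ 2, 2 * d)\<close> and \<open>a - b = (2, 2 * d ^ 3)\<close>.\<close>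
  define a b where "a = ((1 + d\<^sup>2), (1 + d\<^sup>2) * d)" and "b = (d\<^sup>2 - 1, (1 - d\<^sup>2) * d)"
  \<comment> \<open>The corners of a parallelogram whose diagonals join \<open>P 0\<close> to
    \<open>P 3\<close> and \<open>P 1\<close> to \<open>P 2\<close>. The shift by two keeps all
    corners to the right of \<open>c\<close>, since \<open>b\<close> points left by less than
    one.\<close>
  define P where "P k = (c + 2, 0) + (if k \<in> {1, 3} then a else 0) + (if k \<in> {2, 3} then b else 0)" for k :: nat
  have d: "0 < d\<^sup>2" "d\<^sup>2 < 1"
    using assms(2,3) by (auto simp: power_less_one_iff)
  have k: "k = 0 \<or> k = 1 \<or> k = 2 \<or> k = 3" if "k < 4" for k :: nat
    using that by linarith
  \<comment> \<open>Independence of \<open>a\<close> and \<open>b\<close>, so that no three corners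
    are collinear.\<close>
  have det: "fst a * snd b \<noteq> snd a * fst b"
  proof -
    have "fst a * snd b - snd a * fst b = 2 * d * (1 + d\<^sup>2) * (1 - d\<^sup>2)"
      by (simp add: a_def b_def algebra_simps)
    also have "\<dots> > 0"
      using d \<open>0 < d\<close> by (intro mult_pos_pos add_pos_pos) auto
    finally show ?thesis
      by simp
  qed
  have base: "slope (P 0) (P 1) = Some d" "slope (P 2) (P 3) = Some d"
    "slope (P 0) (P 2) = Some (- d)" "slope (P 1) (P 3) = Some (- d)"
    "slope (P 0) (P 3) = Some (1 / d)" "slope (P 1) (P 2) = Some (d ^ 3)"
    using d \<open>0 < d\<close> add_pos_pos[OF zero_less_one d(1)]
    by (intro slope_eqI; simp add: P_def a_def b_def algebra_simps power2_eq_square power3_eq_cube)+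
  have sl: "slope (P i) (P j) \<in> {Some d, Some (- d), Some (1 / d), Some (- (1 / d)), Some (d ^ 3)}"
    if "i < 4" "j < 4" "i \<noteq> j" for i j
    using that(3) k[OF that(1)] k[OF that(2)] base base[THEN trans[OF slope_commute]]
    by (elim disjE) simp_all
  have seg: "P l \<notin> closed_segment (P i) (P j)" if "i < 4" "j < 4" "l < 4" "i \<noteq> j" "l \<noteq> i" "l \<noteq> j" for i j l
    using that k[of i] k[of j] k[of l] det by (auto simp: P_def algebra_simps dest!: segment_cross_product)
  \<comment> \<open>Coinciding points would have slope \<open>None\<close>, which is not among the
    five.\<close>
  have inj: "P i \<noteq> P j" if "i < 4" "j < 4" "i \<noteq> j" for i j
    using sl[OF that] by (auto simp: slope_def)
  have right: "c < fst (P i)" for i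
  proof -
    have "0 < fst a" "- 1 < fst b"
      using d(1) add_pos_pos[OF zero_less_one d(1)] by (simp_all add: a_def b_def)
    then show ?thesis
      by (auto simp: P_def)
  qed
  obtain f where f: "bij_betw f W {..<4::nat}"
    using assms(1) by (metis bij_betw_iff_card card.infinite card_lessThan finite_lessThan zero_neq_numeral)
  have f4: "f v < 4" if "v \<in> W" for v
    using f that by (auto simp: bij_betw_def)
  have f_eq: "f u = f v \<longleftrightarrow> u = v" if "u \<in> W" "v \<in> W" for u v
    using f that by (auto simp: bij_betw_def dest: inj_onD)
  have "drawing {Some d, Some (- d), Some (1 / d), Some (- (1 / d)), Some (d ^ 3)} W E (P \<circ> f)"
    unfolding drawing_def
  proof (intro conjI ballI)
    show "inj_on (P \<circ> f) W"
      using inj f4 f_eq by (auto simp: inj_on_def) metis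
    fix e assume "e \<in> E"
    then obtain u v where e: "e = (u, v)" "u \<in> W" "v \<in> W" "u \<noteq> v"
      using assms(4,5) by (cases e) (auto simp: irrefl_def)
    show "case e of (u, v) \<Rightarrow> slope ((P \<circ> f) u) ((P \<circ> f) v) \<in> {Some d, Some (- d), Some (1 / d), Some (- (1 / d)), Some (d ^ 3)} \<and>
      (\<forall>w\<in>W - {u, v}. (P \<circ> f) w \<notin> closed_segment ((P \<circ> f) u) ((P \<circ> f) v))"
      using e sl seg f4 f_eq by simp
  qed
  then show ?thesis
    using right by (intro exI[of _ "P \<circ> f"]) simp
qed

section \<open>Placing components side by side\<close>

lemma segment_le_fst:
  assumes "w \<in> closed_segment u v" and "fst u \<le> (c :: real)" "fst v \<le> c"
  shows "fst w \<le> c"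
proof -
  have "fst w \<in> closed_segment (fst u) (fst v)"
    using assms(1) by (metis closed_segment_PairD prod.collapse)
  then show ?thesis
    using real_segment_between assms(2,3) by fastforce
qed

lemma segment_less_fst:
  assumes "w \<in> closed_segment u v" and "(c :: real) < fst u" "c < fst v"
  shows "c < fst w"
proof -
  have "fst w \<in> closed_segment (fst u) (fst v)"
    using assms(1) by (metis closed_segment_PairD prod.collapse)
  then show ?thesis
    using real_segment_between assms(2,3) by fastforce
qed

text \<open>The vertical line at \<open>c\<close> separates the two drawings, and a segment stays on
  the side of its ends, so no vertex of one part meets an edge of the other.\<close>

lemma drawing_disjoint_union:
  fixes p p' :: "'a \<Rightarrow> real \<times> real"
  assumes p: "drawing S V E p" "\<And>v. v \<in> V \<Longrightarrow> fst (p v) \<le> c" and E: "E \<subseteq> V \<times> V"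
    and p': "drawing S W E' p'" "\<And>v. v \<in> W \<Longrightarrow> c < fst (p' v)" and E': "E' \<subseteq> W \<times> W"
    and "V \<inter> W = {}"
  shows "drawing S (V \<union> W) (E \<union> E') (\<lambda>v. if v \<in> W then p' v else p v)"
proof -
  let ?p = "\<lambda>v. if v \<in> W then p' v else p v"
  have V: "?p v = p v \<and> fst (p v) \<le> c" if "v \<in> V" for v
    using that p(2) \<open>V \<inter> W = {}\<close> by auto
  have W: "?p v = p' v \<and> c < fst (p' v)" if "v \<in> W" for v
    using that p'(2) by auto
  have VW: "?p v \<noteq> ?p w" if "v \<in> V" "w \<in> W" for v w
    using V[OF that(1)] W[OF that(2)] by (metis not_le)
  have "inj_on ?p (V \<union> W)"
  proof -
    have "inj_on ?p V" "inj_on ?p W"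
      using p(1) p'(1) V W unfolding drawing_def by (simp_all cong: inj_on_cong)
    then show ?thesis
      using VW unfolding inj_on_Un by blast
  qed
  moreover have "slope (?p u) (?p v) \<in> S \<and> (\<forall>w\<in>V \<union> W - {u, v}. ?p w \<notin> closed_segment (?p u) (?p v))"
    if uv: "(u, v) \<in> E \<union> E'" for u v
  proof (cases "(u, v) \<in> E")
    case True
    then have *: "u \<in> V" "v \<in> V" "slope (p u) (p v) \<in> S"
      "\<And>w. w \<in> V \<Longrightarrow> w \<noteq> u \<Longrightarrow> w \<noteq> v \<Longrightarrow> p w \<notin> closed_segment (p u) (p v)"
      using p(1) E unfolding drawing_def by auto
    moreover have "p' w \<notin> closed_segment (p u) (p v)" if "w \<in> W" for w
      using segment_le_fst[of "p' w" "p u" "p v" c] V[OF *(1)] V[OF *(2)] W[OF that] by fastforce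
    ultimately show ?thesis
      using V[of u] V[of v] by auto
  next
    case False
    then have *: "u \<in> W" "v \<in> W" "slope (p' u) (p' v) \<in> S"
      "\<And>w. w \<in> W \<Longrightarrow> w \<noteq> u \<Longrightarrow> w \<noteq> v \<Longrightarrow> p' w \<notin> closed_segment (p' u) (p' v)"
      using uv p'(1) E' unfolding drawing_def by auto
    moreover have "p w \<notin> closed_segment (p' u) (p' v)" if "w \<in> V" for w
      using segment_less_fst[of "p w" "p' u" "p' v" c] W[OF *(1)] W[OF *(2)] V[OF that] by fastforce
    ultimately show ?thesis
      by auto
  qed
  ultimately show ?thesis
    unfolding drawing_def by blast
qed

lemma drawing_mono: "drawing S V E p \<Longrightarrow> S \<subseteq> S' \<Longrightarrow> drawing S' V E p"
  unfolding drawing_def by blast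

text \<open>Four-cliques are split off one at a time and placed to the right of the drawing of the
  rest, until \<open>drawing_without_four_clique\<close> applies. One \<open>d\<close> serves all
  stages, because \<open>d * card V \<le> 1\<close> persists for smaller vertex sets.\<close>

lemma subcubic_drawing:
  fixes d :: real
  assumes "finite V" and "E \<subseteq> V \<times> V" and "sym E" and "irrefl E" and "\<And>v. card (E `` {v}) \<le> 3"
    and "0 < d" "d < 1" and "d * card V \<le> 1"
  shows "\<exists>p. drawing {Some d, Some (- d), Some (1 / d), Some (- (1 / d)), Some (d ^ 3)} V E p"
  using assms
proof (induction "card V" arbitrary: V E rule: less_induct)
  case less
  show ?case
  proof (cases "\<exists>W\<subseteq>V. card W = 4 \<and> (\<forall>u\<in>W. \<forall>v\<in>W. u \<noteq> v \<longrightarrow> (u, v) \<in> E)")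
    case False
    then have no_clique: "\<exists>u\<in>W. \<exists>v\<in>W. u \<noteq> v \<and> (u, v) \<notin> E" if "W \<subseteq> V" "card W = 4" for W
      using that by blast
    have "\<exists>p. drawing {Some d, Some (- d), Some (1 / d), Some (- (1 / d))} V E p"
      by (rule drawing_without_four_clique[OF less.prems(1-5) no_clique less.prems(6,8)])
    then show ?thesis
      by (elim exE, intro exI) (erule drawing_mono, blast)
  next
    case True
    then obtain W where W: "W \<subseteq> V" "card W = 4" "\<And>u v. u \<in> W \<Longrightarrow> v \<in> W \<Longrightarrow> u \<noteq> v \<Longrightarrow> (u, v) \<in> E"
      by blast
    have "finite E"
      using less.prems(1,2) finite_subset by blast
    then have fin: "finite W" "finite (E `` {v})" for v
      using W(1) less.prems(1) by (auto intro: finite_subset)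
    \<comment> \<open>The three other clique vertices exhaust the degree of \<open>u\<close>, so the
      clique is a whole component.\<close>
    have closed: "v \<in> W" if "u \<in> W" "(u, v) \<in> E" for u v
    proof -
      have "W - {u} = E `` {u}"
        using W that less.prems(5)[of u] fin by (intro card_seteq) auto
      then show ?thesis
        using that by blast
    qed
    let ?V = "V - W" and ?E = "E \<inter> (V - W) \<times> (V - W)" and ?E' = "E \<inter> W \<times> W"
    have "card ?V = card V - 4" "4 \<le> card V"
      using W(1,2) less.prems(1) fin(1) card_Diff_subset card_mono by metis+
    then have "card ?V < card V"
      by simp
    then have "\<exists>p. drawing {Some d, Some (- d), Some (1 / d), Some (- (1 / d)), Some (d ^ 3)} ?V ?E p"
    proof (rule less.hyps)
      show "sym ?E" "irrefl ?E"
        using less.prems(3,4) by (auto simp: sym_def irrefl_def)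
      show "card (?E `` {v}) \<le> 3" for v
        using less.prems(5)[of v] card_mono[OF fin(2)[of v], of "?E `` {v}"] by force
      show "d * card ?V \<le> 1"
        using less.prems(6,8) \<open>card ?V < card V\<close>
        by (meson less_imp_le mult_left_mono of_nat_mono order_trans)
    qed (use less.prems in auto)
    then obtain p where p: "drawing {Some d, Some (- d), Some (1 / d), Some (- (1 / d)), Some (d ^ 3)} ?V ?E p"
      by blast
    \<comment> \<open>The inserted zero keeps the maximum defined when no other vertex is
      left.\<close>
    define c where "c = Max (insert 0 ((fst \<circ> p) ` ?V))"
    have c: "fst (p v) \<le> c" if "v \<in> ?V" for v
      using that less.prems(1) unfolding c_def by (intro Max_ge) auto
    have "irrefl ?E'"
      using less.prems(4) by (auto simp: irrefl_def)
    then obtain p' where p': "drawing {Some d, Some (- d), Some (1 / d), Some (- (1 / d)), Some (d ^ 3)} W ?E' p'"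
      "\<And>v. v \<in> W \<Longrightarrow> c < fst (p' v)"
      using four_clique_drawing[OF W(2) less.prems(6,7), of ?E' c] by blast
    have "drawing {Some d, Some (- d), Some (1 / d), Some (- (1 / d)), Some (d ^ 3)} (?V \<union> W) (?E \<union> ?E')
      (\<lambda>v. if v \<in> W then p' v else p v)"
      by (rule drawing_disjoint_union[OF p c _ p']) auto
    moreover have "?V \<union> W = V"
      using W(1) by blast
    moreover have "?E \<union> ?E' = E"
      using less.prems(2,3) closed by (auto dest: symD)
    ultimately show ?thesis
      by metis
  qed
qed

section \<open>Passage from relations to digraphs\<close>

lemma (in graph) subcubic_slope_number:
  assumes "\<forall>v \<in> verts G. out_degree G v \<le> 3"
  shows "slope_number G \<le> 5"
proof -
  let ?V = "verts G" and ?E = "arcs_ends G"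
  \<comment> \<open>The summand two gives \<open>d < 1\<close> even for the empty graph.\<close>
  define d where "d = 1 / (real (card ?V) + 2)"
  define S where "S = {Some d, Some (- d), Some (1 / d), Some (- (1 / d)), Some (d ^ 3)}"
  have d: "0 < d" "d < 1" "d * card ?V \<le> 1"
    by (simp_all add: d_def field_simps)
  have E: "(u, v) \<in> ?E \<longleftrightarrow> (\<exists>e\<in>arcs G. u = tail G e \<and> v = head G e)" for u v
    by (auto simp: arcs_ends_def arc_to_ends_def)
  have deg: "card (?E `` {v}) \<le> 3" for v
  proof (cases "v \<in> ?V")
    case True
    have "?E `` {v} = head G ` out_arcs G v"
      by (auto simp: E out_arcs_def)
    then have "card (?E `` {v}) \<le> out_degree G v"
      using card_image_le[OF finite_out_arcs] by (simp add: out_degree_def)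
    then show ?thesis
      using True assms by fastforce
  next
    case False
    then have "?E `` {v} = {}"
      by (auto simp: E)
    then show ?thesis
      by simp
  qed
  have "\<exists>p. drawing S ?V ?E p"
    unfolding S_def
  proof (rule subcubic_drawing[OF finite_verts _ _ _ deg d])
    show "?E \<subseteq> ?V \<times> ?V"
      by (auto simp: E)
    show "sym ?E"
      using sym_arcs by (simp add: symmetric_def)
    show "irrefl ?E"
      using no_loops by (auto simp: irrefl_def E)
  qed
  then obtain p where p: "drawing S ?V ?E p"
    by blast
  have arc: "slope (p (tail G e)) (p (head G e)) \<in> S \<and>
    (\<forall>w\<in>?V - {tail G e, head G e}. p w \<notin> closed_segment (p (tail G e)) (p (head G e)))"
    if "e \<in> arcs G" for e
  proof -
    have "(tail G e, head G e) \<in> ?E"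
      using that by (auto simp: E)
    then show ?thesis
      using p unfolding drawing_def by blast
  qed
  then have "straight_line_drawing G p"
    using p unfolding drawing_def straight_line_drawing_def by blast
  moreover have "drawing_slopes G p \<subseteq> S"
    using arc unfolding drawing_slopes_def by blast
  then have "card (drawing_slopes G p) \<le> card S"
    by (rule card_mono[rotated]) (simp add: S_def)
  \<comment> \<open>The length of the list bounds the number of slopes, whether or not some of them
    coincide.\<close>
  moreover have "card S \<le> 5"
    using card_length[of "[Some d, Some (- d), Some (1 / d), Some (- (1 / d)), Some (d ^ 3)]"] by (simp add: S_def)
  ultimately show ?thesis
    unfolding slope_number_le_iff by (meson order_trans)
qed

theorem theorem6p1:
  fixes G :: "('a, 'b) pre_digraph"
  assumes "graph G"
    and "\<forall>v \<in> verts G. out_degree G v \<le> 3"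
  shows "slope_number G \<le> 5"
  using graph.subcubic_slope_number[OF assms] .

end
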